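(* Let $\Sigma$ be a finite alphabet, let $q\ge1$ be an integer and let $\varepsilon\in(0,1]$. (1) Let $\delta\in(0,1]$. There are a constant $C$ depending only on $q,\delta,|\Sigma|$ and a threshold $n_0$ (which may also depend on $\varepsilon$) such that for every $n\ge n_0$ and every $\Pi\subseteq\Sigma^n$: if there is a one-sided nonadaptive tester for $\Pi$ with maximum query complexity at most $q$ which rejects every input that is $\varepsilon/2$-far from $\Pi$ with probability at least $\delta$, then $\Pi$ has a sample-based tester which rejects every $x\in\Pi$ with probability $0$, rejects every $x$ that is $\varepsilon$-far from $\Pi$ with probability at least $2/3$, and has expected sample complexity at most $$C\,n^{1-1/(\lfloor q/\delta\rfloor+1)}.$$ (2) Let $0\le\gamma<\delta\le1$. There are a constant $C$ depending only on $q,\gamma,\delta,|\Sigma|$ and a threshold $n_0$ (which may also depend on $\varepsilon$) such that for every $n\ge n_0$ and every $\Pi\subseteq\Sigma^n$: if there is a nonadaptive tester with maximum query complexity at most $q$ which rejects every input in $\Pi$ with probability at most $\gamma$ and rejects every input that is $\varepsilon/2$-far from $\Pi$ with probability at least $\delta$, then $\Pi$ has a sample-based tester which accepts every $x\in\Pi$ with probability at least $2/3$, rejects every $x$ that is $\varepsilon$-far from $\Pi$ with probability at least $2/3$, and has expected sample complexity at most $$C\,n^{1-1/(\lfloor q/(\delta-\gamma)\rfloor+1)}.$$ (3) In particular, for $\gamma=1/3$ and $\delta=2/3$, the bound in (2) is $O_{q,|\Sigma|}\bigl(n^{1-1/(3q+1)}\bigr)=n^{1-\Theta(1/q)}$.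
   Context: For $x,y\in\Sigma^n$, $\operatorname{dist}(x,y)=\frac1n|\{i\in[n]:x_i\ne y_i\}|$, and $\operatorname{dist}(x,\Pi)=\min_{y\in\Pi}\operatorname{dist}(x,y)$. The word $x$ is $\varepsilon$-far from $\Pi$ if $\operatorname{dist}(x,\Pi)>\varepsilon$. A deterministic local test is a pair $t=(Q_t,\varphi_t)$ with $Q_t\subseteq[n]$ and $\varphi_t:\Sigma^{Q_t}\to\{0,1\}$, where $\varphi_t=1$ means rejection. A nonadaptive tester $T$ is given by a probability distribution $\mu$ on a finite set (index set) $\mathcal T$ of local tests: it samples $t\sim\mu$, queries the coordinates in $Q_t$, and outputs $\varphi_t(x|_{Q_t})$. Its rejection probability on $x$ is $r_T(x)=\mu(\{t\in\mathcal T:\varphi_t(x|_{Q_t})=1\})$, and its maximum query complexity is $\max_{t\in\operatorname{supp}(\mu)}|Q_t|$. The tester is one-sided for $\Pi$ if $r_T(x)=0$ for every $x\in\Pi$. For $p\in[0,1]$, a $p$-sampling tester receives $(W,x|_W)$, where $W\subseteq[n]$ is the random set containing each coordinate independently with probability $p$, and applies arbitrary post-processing (no running-time bound) to decide whether to accept or reject. Its expected sample complexity is $\mathbb E|W|=pn$. A sample-based tester is a $p$-sampling tester for some $p\in[0,1]$. *)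

theory Defs
  imports "HOL-Probability.Probability" "HOL-Library.Landau_Symbols"
begin

text \<open>
  Words over an alphabet \<open>\<Sigma>\<close> are extensional functions on \<open>{1..n}\<close>, so that
  \<open>restrict x Q\<close> is the subword of \<open>x\<close> on the coordinates in \<open>Q\<close>, an element of
  \<open>Q \<rightarrow>\<^sub>E \<Sigma>\<close>.
\<close>

definition words :: "nat \<Rightarrow> 'a set \<Rightarrow> (nat \<Rightarrow> 'a) set" where
  "words n \<Sigma> = {1..n} \<rightarrow>\<^sub>E \<Sigma>"

definition rel_dist :: "nat \<Rightarrow> (nat \<Rightarrow> 'a) \<Rightarrow> (nat \<Rightarrow> 'a) \<Rightarrow> real" where
  "rel_dist n x y = real (card {i \<in> {1..n}. x i \<noteq> y i}) / real n"

text \<open>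
  The infimum is taken in the extended reals: it is the minimum for a nonempty finite
  property, and it is \<open>\<infinity>\<close> for the empty property, from which every word is therefore far.
\<close>

definition dist_to :: "nat \<Rightarrow> (nat \<Rightarrow> 'a) \<Rightarrow> (nat \<Rightarrow> 'a) set \<Rightarrow> ereal" where
  "dist_to n x P = (INF y\<in>P. ereal (rel_dist n x y))"

definition far_from :: "nat \<Rightarrow> real \<Rightarrow> (nat \<Rightarrow> 'a) \<Rightarrow> (nat \<Rightarrow> 'a) set \<Rightarrow> bool" where
  "far_from n \<epsilon> x P \<longleftrightarrow> dist_to n x P > ereal \<epsilon>"

lemma dist_to_eq_Min:
  assumes "finite P" "P \<noteq> {}"
  shows "dist_to n x P = ereal (Min (rel_dist n x ` P))"
proof -
  have fin: "finite (rel_dist n x ` P)" "rel_dist n x ` P \<noteq> {}"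
    using assms by auto
  have "Min (rel_dist n x ` P) \<in> rel_dist n x ` P"
    using fin by (rule Min_in)
  then obtain z where z: "z \<in> P" "Min (rel_dist n x ` P) = rel_dist n x z"
    by auto
  show ?thesis
    unfolding dist_to_def
  proof (rule antisym)
    show "(INF y\<in>P. ereal (rel_dist n x y)) \<le> ereal (Min (rel_dist n x ` P))"
      using z by (auto intro: INF_lower)
    show "ereal (Min (rel_dist n x ` P)) \<le> (INF y\<in>P. ereal (rel_dist n x y))"
      using fin by (auto intro!: INF_greatest)
  qed
qed


subsection \<open>Nonadaptive testers\<close>

text \<open>
  \<open>rejects t\<close> is only ever applied to subwords on \<open>queries t\<close>; \<open>True\<close> means rejection.
\<close>

datatype 'a local_test =
  Local_Test (queries: "nat set") (rejects: "(nat \<Rightarrow> 'a) \<Rightarrow> bool")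

datatype 'a tester =
  Tester (tests: "'a local_test set") (test_dist: "'a local_test pmf")

definition nonadaptive_tester :: "nat \<Rightarrow> 'a tester \<Rightarrow> bool" where
  "nonadaptive_tester n T \<longleftrightarrow>
     finite (tests T) \<and> set_pmf (test_dist T) \<subseteq> tests T \<and> (\<forall>t\<in>tests T. queries t \<subseteq> {1..n})"

definition reject_prob :: "'a tester \<Rightarrow> (nat \<Rightarrow> 'a) \<Rightarrow> real" where
  "reject_prob T x =
     measure_pmf.prob (test_dist T) {t \<in> tests T. rejects t (restrict x (queries t))}"

definition max_queries :: "'a tester \<Rightarrow> nat" where
  "max_queries T = Max ((\<lambda>t. card (queries t)) ` set_pmf (test_dist T))"

definition one_sided :: "'a tester \<Rightarrow> (nat \<Rightarrow> 'a) set \<Rightarrow> bool" where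
  "one_sided T P \<longleftrightarrow> (\<forall>x\<in>P. reject_prob T x = 0)"


subsection \<open>Sample-based testers\<close>

definition random_coords :: "nat \<Rightarrow> real \<Rightarrow> nat set pmf" where
  "random_coords n p =
     map_pmf (\<lambda>b. {i \<in> {1..n}. b i}) (Pi_pmf {1..n} False (\<lambda>_. bernoulli_pmf p))"

text \<open>
  Post-processing may use private randomness: given the sample \<open>(W, x|\<^sub>W)\<close> it yields a
  distribution on verdicts, where \<open>True\<close> again means rejection.
\<close>

datatype 'a sampling_tester =
  Sampling_Tester (sampling_rate: real)
    (postprocess: "nat set \<Rightarrow> (nat \<Rightarrow> 'a) \<Rightarrow> bool pmf")

definition sample_based_tester :: "'a sampling_tester \<Rightarrow> bool" where
  "sample_based_tester S \<longleftrightarrow> sampling_rate S \<in> {0..1}"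

definition verdict :: "nat \<Rightarrow> 'a sampling_tester \<Rightarrow> (nat \<Rightarrow> 'a) \<Rightarrow> bool pmf" where
  "verdict n S x =
     bind_pmf (random_coords n (sampling_rate S)) (\<lambda>W. postprocess S W (restrict x W))"

definition sample_reject_prob :: "nat \<Rightarrow> 'a sampling_tester \<Rightarrow> (nat \<Rightarrow> 'a) \<Rightarrow> real" where
  "sample_reject_prob n S x = pmf (verdict n S x) True"

definition sample_accept_prob :: "nat \<Rightarrow> 'a sampling_tester \<Rightarrow> (nat \<Rightarrow> 'a) \<Rightarrow> real" where
  "sample_accept_prob n S x = pmf (verdict n S x) False"

definition expected_samples :: "nat \<Rightarrow> 'a sampling_tester \<Rightarrow> real" where
  "expected_samples n S =
     measure_pmf.expectation (random_coords n (sampling_rate S)) (\<lambda>W. real (card W))"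

lemma expected_samples_eq:
  assumes "sample_based_tester S"
  shows "expected_samples n S = sampling_rate S * real n"
proof -
  define p where "p = sampling_rate S"
  have p: "0 \<le> p" "p \<le> 1"
    using assms by (auto simp: sample_based_tester_def p_def)
  let ?B = "Pi_pmf {1..n} False (\<lambda>_. bernoulli_pmf p)"
  have card: "real (card {i \<in> {1..n}. b i}) = (\<Sum>i\<in>{1..n}. of_bool (b i))" for b :: "nat \<Rightarrow> bool"
    by (simp add: of_bool_def sum.If_cases Int_def)
  have "finite (set_pmf ?B)"
    by (rule finite_subset[OF set_Pi_pmf_subset']) (auto intro!: finite_PiE_dflt)
  hence int: "integrable ?B f" for f :: "(nat \<Rightarrow> bool) \<Rightarrow> real"
    by (rule integrable_measure_pmf_finite)
  have one: "measure_pmf.expectation ?B (\<lambda>b. of_bool (b i)) = p" if "i \<in> {1..n}" for i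
  proof -
    have "measure_pmf.expectation ?B (\<lambda>b. of_bool (b i))
        = measure_pmf.expectation (map_pmf (\<lambda>b. b i) ?B) (of_bool :: bool \<Rightarrow> real)"
      by (simp add: integral_map_pmf)
    also have "map_pmf (\<lambda>b. b i) ?B = bernoulli_pmf p"
      using that by (subst Pi_pmf_component) auto
    finally show ?thesis
      using p by simp
  qed
  have "expected_samples n S = measure_pmf.expectation ?B (\<lambda>b. \<Sum>i\<in>{1..n}. of_bool (b i))"
    by (simp only: expected_samples_def random_coords_def integral_map_pmf card p_def)
  also have "\<dots> = (\<Sum>i\<in>{1..n}. measure_pmf.expectation ?B (\<lambda>b. of_bool (b i)))"
    by (rule Bochner_Integration.integral_sum) (rule int)
  also have "\<dots> = p * real n"
    using one by simp
  finally show ?thesis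
    by (simp add: p_def)
qed

end

theory Submission
  imports Defs
begin

text \<open>
  Call \<open>degree v\<close> the probability that the tester queries \<open>v\<close>, let \<open>p\<close> be the sampling rate and
  \<open>\<beta> = c p\<close> for a small constant \<open>c\<close>. At level \<open>L\<close>, the coordinates of degree greater than
  \<open>\<beta> ^ L\<close> form the kernel, of size at most \<open>q / \<beta> ^ L\<close>, and the other coordinates queried by a
  test are its petals. The level is good for a test if the \<open>b\<close>-th largest degree among its petals
  is at most \<open>\<beta> ^ (L + b)\<close>, for all \<open>b\<close>. By a parking argument a test with \<open>q\<close> queries
  has at most \<open>q\<close> bad levels, so one of the levels \<open>0, \<dots>, m\<close>, where
  \<open>m = \<lfloor>q / (\<delta> - \<gamma>)\<rfloor>\<close>, is bad with probability at most
  \<open>q / (m + 1) < \<delta> - \<gamma>\<close>, and the tests bad at that level can be discarded.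

  The sample-based tester guesses the word on the kernel and estimates the rejection probability of
  the remaining tests by weighting those whose petals are all sampled; it rejects if the estimate
  is large for every guess. For a word of \<open>P\<close> the correct guess gives a small estimate, by
  Chebyshev's inequality. A far word stays \<open>\<epsilon>/2\<close>-far when the kernel is overwritten, and by
  Janson's inequality a single guess fails with probability \<open>exp (- K / \<beta> ^ L)\<close> for a large
  constant \<open>K\<close>, which beats the number \<open>\<bar>\<Sigma>\<bar> ^ (q / \<beta> ^ L)\<close> of guesses.
\<close>

section \<open>Random subsets\<close>

text \<open>The model behind \<open>random_coords\<close> on an arbitrary ground set, so that
  inductions can remove one element at a time.\<close>

definition random_subset :: "'b set \<Rightarrow> real \<Rightarrow> 'b set pmf" where
  "random_subset A p = map_pmf (\<lambda>b. {i \<in> A. b i}) (Pi_pmf A False (\<lambda>_. bernoulli_pmf p))"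

abbreviation subset_mean :: "'b set \<Rightarrow> real \<Rightarrow> ('b set \<Rightarrow> real) \<Rightarrow> real" where
  "subset_mean A p \<equiv> measure_pmf.expectation (random_subset A p)"

lemma random_coords_eq: "random_coords n p = random_subset {1..n} p"
  by (simp add: random_coords_def random_subset_def)

lemma set_random_subset: "set_pmf (random_subset A p) \<subseteq> Pow A"
  by (auto simp: random_subset_def)

lemma integrable_random_subset:
  fixes f :: "'b set \<Rightarrow> real"
  assumes "finite A"
  shows "integrable (measure_pmf (random_subset A p)) f"
  using assms set_random_subset[of A p]
  by (intro integrable_measure_pmf_finite) (meson finite_Pow_iff finite_subset)

lemma subset_mean_mono:
  assumes "finite A" "\<And>W. W \<subseteq> A \<Longrightarrow> f W \<le> g W"
  shows "subset_mean A p f \<le> subset_mean A p g"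
  using assms set_random_subset[of A p]
  by (intro integral_mono_AE integrable_random_subset) (auto simp: AE_measure_pmf_iff)

lemma subset_mean_cong:
  assumes "\<And>W. W \<subseteq> A \<Longrightarrow> f W = g W"
  shows "subset_mean A p f = subset_mean A p g"
  using assms set_random_subset[of A p]
  by (intro integral_cong_AE) (auto simp: AE_measure_pmf_iff)

lemma subset_mean_empty: "subset_mean {} p f = f {}"
  by (simp add: random_subset_def)

text \<open>Conditioning on whether \<open>v\<close> is sampled; this recursion drives the
  inductions below.\<close>

lemma subset_mean_insert:
  assumes "finite A" "v \<notin> A" "0 \<le> p" "p \<le> 1"
  shows "subset_mean (insert v A) p f
    = p * subset_mean A p (\<lambda>W. f (insert v W)) + (1 - p) * subset_mean A p f"
proof -
  have *: "{i. (i = v \<or> i \<in> A) \<and> (b(v := c)) i} = (if c then insert v {i \<in> A. b i} else {i \<in> A. b i})"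
    for b c using assms(2) by auto
  have "random_subset (insert v A) p = bind_pmf (bernoulli_pmf p)
      (\<lambda>c. map_pmf (\<lambda>W. if c then insert v W else W) (random_subset A p))"
    using assms
    by (simp add: random_subset_def Pi_pmf_insert' map_bind_pmf map_pmf_comp * bind_return_pmf
        flip: map_pmf_def)
       (auto simp: map_pmf_def bind_assoc_pmf bind_return_pmf
         intro!: bind_pmf_cong arg_cong[where f = return_pmf] split: if_splits)
  also have "measure_pmf.expectation \<dots> f
      = measure_pmf.expectation (bernoulli_pmf p) (\<lambda>c. subset_mean A p (\<lambda>W. f (if c then insert v W else W)))"
  proof (subst pmf_expectation_bind[where A = UNIV])
    show "finite (set_pmf (map_pmf (\<lambda>W. if c then insert v W else W) (random_subset A p)))" for c
      using assms(1) set_random_subset[of A p] by (auto intro: finite_subset)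
  qed (auto simp: integral_measure_pmf_real[where A = UNIV] UNIV_bool mult.commute)
  also have "\<dots> = p * subset_mean A p (\<lambda>W. f (insert v W)) + (1 - p) * subset_mean A p f"
    using assms by simp
  finally show ?thesis .
qed

text \<open>Decreasing functions are positively correlated. Conditioning on one element, the
  induction hypothesis applies within each of the two outcomes, and between them both conditional
  means move the same way.\<close>

lemma subset_mean_harris:
  assumes "finite A" "0 \<le> p" "p \<le> 1"
    and "\<And>V W. V \<subseteq> W \<Longrightarrow> W \<subseteq> A \<Longrightarrow> f W \<le> f V"
    and "\<And>V W. V \<subseteq> W \<Longrightarrow> W \<subseteq> A \<Longrightarrow> g W \<le> g V"
  shows "subset_mean A p f * subset_mean A p g \<le> subset_mean A p (\<lambda>W. f W * g W)"
  using assms(1,4,5)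
proof (induction A arbitrary: f g rule: finite_induct)
  case empty
  then show ?case by (simp add: subset_mean_empty)
next
  case (insert v A)
  let ?f1 = "\<lambda>W. f (insert v W)" and ?g1 = "\<lambda>W. g (insert v W)"
  let ?E = "subset_mean A p"
  have 1: "?E ?f1 * ?E ?g1 \<le> ?E (\<lambda>W. ?f1 W * ?g1 W)"
    by (intro insert.IH insert.prems) auto
  have 0: "?E f * ?E g \<le> ?E (\<lambda>W. f W * g W)"
    by (intro insert.IH insert.prems) auto
  have f: "?E ?f1 \<le> ?E f" and g: "?E ?g1 \<le> ?E g"
    using insert by (auto intro!: subset_mean_mono insert.prems)
  \<comment> \<open>The covariance of the two conditional means.\<close>
  have "0 \<le> p * (1 - p) * ((?E f - ?E ?f1) * (?E g - ?E ?g1))"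
    using f g assms by simp
  then have "(p * ?E ?f1 + (1 - p) * ?E f) * (p * ?E ?g1 + (1 - p) * ?E g)
      \<le> p * (?E ?f1 * ?E ?g1) + (1 - p) * (?E f * ?E g)"
    by (simp add: algebra_simps)
  also have "\<dots> \<le> p * ?E (\<lambda>W. ?f1 W * ?g1 W) + (1 - p) * ?E (\<lambda>W. f W * g W)"
    using 0 1 assms by (intro add_mono mult_left_mono) auto
  finally show ?case
    using insert assms by (simp add: subset_mean_insert)
qed

text \<open>Given \<open>T \<subseteq> W\<close>, an event of probability \<open>p ^ card T\<close>,
  the sample is distributed as \<open>W \<union> T\<close> with \<open>W\<close> unconditioned. The
  elements of \<open>T\<close> are exposed one at a time, so \<open>f\<close> stays arbitrary in the
  induction.\<close>

lemma subset_mean_superset: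
  assumes "finite A" "0 \<le> p" "p \<le> 1" "T \<subseteq> A"
  shows "subset_mean A p (\<lambda>W. of_bool (T \<subseteq> W) * f W) = p ^ card T * subset_mean A p (\<lambda>W. f (W \<union> T))"
proof -
  have "finite T" using assms finite_subset by blast
  then show ?thesis using assms(4)
  proof (induction T arbitrary: f rule: finite_induct)
    case empty
    then show ?case by simp
  next
    case (insert v T)
    have rec: "subset_mean A p g
        = p * subset_mean (A - {v}) p (\<lambda>W. g (insert v W)) + (1 - p) * subset_mean (A - {v}) p g" for g
      using subset_mean_insert[of "A - {v}" v p g] insert.prems assms by (simp add: insert_absorb)
    have single: "subset_mean A p (\<lambda>W. of_bool (v \<in> W) * g W) = p * subset_mean A p (\<lambda>W. g (insert v W))"
      for g
    proof -
      have "subset_mean (A - {v}) p (\<lambda>W. of_bool (v \<in> W) * g W) = subset_mean (A - {v}) p (\<lambda>_. 0)"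
        by (rule subset_mean_cong) auto
      then show ?thesis
        by (simp add: rec algebra_simps)
    qed
    have "subset_mean A p (\<lambda>W. of_bool (insert v T \<subseteq> W) * f W)
        = subset_mean A p (\<lambda>W. of_bool (v \<in> W) * (of_bool (T \<subseteq> W) * f W))"
      by (simp add: of_bool_conj mult.assoc)
    also have "\<dots> = p * subset_mean A p (\<lambda>W. of_bool (T \<subseteq> insert v W) * f (insert v W))"
      by (rule single)
    also have "\<dots> = p * subset_mean A p (\<lambda>W. of_bool (T \<subseteq> W) * f (insert v W))"
      using insert by (simp add: subset_insert)
    also have "\<dots> = p * (p ^ card T * subset_mean A p (\<lambda>W. f (insert v (W \<union> T))))"
      using insert by simp
    finally show ?case using insert by (simp add: algebra_simps)
  qed
qed

lemma subset_mean_superset_1: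
  assumes "finite A" "0 \<le> p" "p \<le> 1" "T \<subseteq> A"
  shows "subset_mean A p (\<lambda>W. of_bool (T \<subseteq> W)) = p ^ card T"
  using subset_mean_superset[OF assms, of "\<lambda>_. 1"] by simp

section \<open>Weighted counts of sampled sets\<close>

text \<open>To be used with rejecting tests as indices and their petals as \<open>B\<close>.\<close>

locale subset_count =
  fixes A :: "'b set" and p :: real and I :: "'i set" and w :: "'i \<Rightarrow> real" and B :: "'i \<Rightarrow> 'b set"
  assumes finite_ground: "finite A" and finite_index: "finite I"
    and p: "0 \<le> p" "p \<le> 1"
    and w_nonneg: "\<And>t. t \<in> I \<Longrightarrow> 0 \<le> w t"
    and B_subset: "\<And>t. t \<in> I \<Longrightarrow> B t \<subseteq> A"
begin

definition count :: "'b set \<Rightarrow> real" where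
  "count W = (\<Sum>t\<in>I. w t * of_bool (B t \<subseteq> W))"

definition expected_count :: real where
  "expected_count = (\<Sum>t\<in>I. w t * p ^ card (B t))"

text \<open>Janson's dependency term over ordered pairs. It includes the diagonal pairs with
  \<open>B t\<close> nonempty, so it also bounds the variance.\<close>

definition overlap :: real where
  "overlap = (\<Sum>t\<in>I. \<Sum>u\<in>{u \<in> I. B t \<inter> B u \<noteq> {}}. w t * w u * p ^ card (B t \<union> B u))"

abbreviation \<E> :: "('b set \<Rightarrow> real) \<Rightarrow> real" where
  "\<E> \<equiv> subset_mean A p"

lemmas integ = integrable_random_subset[OF finite_ground, of p]

section \<open>Mean, second moment and upper tail\<close>

lemma mean_count: "\<E> count = expected_count"
  unfolding count_def[abs_def] expected_count_def
  using B_subset finite_ground p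
  by (simp add: integ subset_mean_superset_1)

text \<open>Indices with disjoint sets are independent, so their pairs contribute at most
  \<open>expected_count\<^sup>2\<close> to the second moment; the other pairs form
  \<open>overlap\<close>.\<close>

lemma second_moment_le: "\<E> (\<lambda>W. (count W - expected_count)\<^sup>2) \<le> overlap"
proof -
  have card_Un: "card (B t \<union> B u) = card (B t) + card (B u)" if "B t \<inter> B u = {}" "t \<in> I" "u \<in> I" for t u
    using that B_subset finite_ground by (intro card_Un_disjoint) (auto intro: finite_subset)
  have both: "\<E> (\<lambda>W. of_bool (B t \<subseteq> W \<and> B u \<subseteq> W)) = p ^ card (B t \<union> B u)" if "t \<in> I" "u \<in> I" for t u
    using subset_mean_superset_1[OF finite_ground p, of "B t \<union> B u"] that B_subset by simp
  have "(count W)\<^sup>2 = (\<Sum>t\<in>I. \<Sum>u\<in>I. w t * w u * of_bool (B t \<union> B u \<subseteq> W))" for W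
    by (simp add: count_def power2_eq_square sum_product of_bool_conj algebra_simps)
  then have "\<E> (\<lambda>W. (count W)\<^sup>2) = (\<Sum>t\<in>I. \<Sum>u\<in>I. w t * w u * p ^ card (B t \<union> B u))"
    using B_subset finite_ground p
    by (simp add: integ both)
  also have "\<dots> = (\<Sum>t\<in>I. (\<Sum>u\<in>{u \<in> I. B t \<inter> B u \<noteq> {}}. w t * w u * p ^ card (B t \<union> B u))
      + (\<Sum>u\<in>{u \<in> I. B t \<inter> B u = {}}. w t * w u * p ^ card (B t \<union> B u)))"
    using finite_index
    by (intro sum.cong refl, subst sum.union_disjoint[symmetric]) (auto intro: sum.cong)
  also have "\<dots> = overlap + (\<Sum>t\<in>I. \<Sum>u\<in>{u \<in> I. B t \<inter> B u = {}}. w t * w u * (p ^ card (B t) * p ^ card (B u)))"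
    by (simp add: sum.distrib overlap_def card_Un power_add)
  \<comment> \<open>Completing the sum to all pairs adds nonnegative terms and produces a
    square.\<close>
  also have "\<dots> \<le> overlap + (\<Sum>t\<in>I. \<Sum>u\<in>I. w t * w u * (p ^ card (B t) * p ^ card (B u)))"
    using finite_index w_nonneg p by (intro add_left_mono sum_mono sum_mono2) auto
  also have "\<dots> = overlap + expected_count\<^sup>2"
    by (simp add: expected_count_def power2_eq_square sum_product algebra_simps)
  finally have "\<E> (\<lambda>W. (count W)\<^sup>2) \<le> overlap + expected_count\<^sup>2" .
  moreover have "\<E> (\<lambda>W. (count W - expected_count)\<^sup>2) = \<E> (\<lambda>W. (count W)\<^sup>2) - expected_count\<^sup>2"
    by (simp add: power2_diff integ mean_count) (simp add: power2_eq_square)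
  ultimately show ?thesis by simp
qed

lemma upper_tail:
  assumes "0 < d"
  shows "measure_pmf.prob (random_subset A p) {W. expected_count + d < count W} \<le> overlap / d\<^sup>2"
proof -
  have "measure_pmf.prob (random_subset A p) {W. expected_count + d < count W}
      = \<E> (indicator {W. expected_count + d < count W})"
    by simp
  also have "\<dots> \<le> \<E> (\<lambda>W. (count W - expected_count)\<^sup>2 / d\<^sup>2)"
  proof (rule subset_mean_mono[OF finite_ground])
    show "indicator {W. expected_count + d < count W} W \<le> (count W - expected_count)\<^sup>2 / d\<^sup>2" for W
      using assms power_mono[of d "count W - expected_count" 2] by (auto simp: indicator_def)
  qed
  also have "\<dots> \<le> overlap / d\<^sup>2"
    using second_moment_le assms by (simp add: divide_right_mono)
  finally show ?thesis .
qed

section \<open>Exponential moments and lower tail\<close>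

definition laplace :: "real \<Rightarrow> real" where
  "laplace s = \<E> (\<lambda>W. exp (- (s * count W)))"

text \<open>The sample space \<open>Pow A\<close> is finite, so the expectation is a finite sum,
  differentiated termwise; expanding \<open>count\<close> gives one term per index.\<close>

lemma laplace_deriv:
  "(laplace has_real_derivative - (\<Sum>t\<in>I. w t * \<E> (\<lambda>W. of_bool (B t \<subseteq> W) * exp (- (s * count W))))) (at s)"
proof -
  let ?R = "random_subset A p"
  have fin: "finite (Pow A)" and sub: "set_pmf ?R \<subseteq> Pow A"
    using finite_ground set_random_subset by auto
  have E: "\<E> f = (\<Sum>W\<in>Pow A. f W * pmf ?R W)" for f
    using sub by (intro integral_measure_pmf_real[OF fin]) auto
  have "laplace = (\<lambda>s. \<Sum>W\<in>Pow A. exp (- (s * count W)) * pmf ?R W)"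
    by (simp add: laplace_def[abs_def] E)
  moreover have "((\<lambda>s. \<Sum>W\<in>Pow A. exp (- (s * count W)) * pmf ?R W) has_real_derivative
      (\<Sum>W\<in>Pow A. exp (- (s * count W)) * (- count W) * pmf ?R W)) (at s)"
    by (auto intro!: derivative_eq_intros sum.cong)
  moreover have "(\<Sum>W\<in>Pow A. exp (- (s * count W)) * (- count W) * pmf ?R W)
      = - (\<Sum>t\<in>I. w t * \<E> (\<lambda>W. of_bool (B t \<subseteq> W) * exp (- (s * count W))))"
    unfolding E sum_distrib_left
    by (subst sum.swap)
       (simp add: count_def sum_distrib_left sum_distrib_right sum_negf[symmetric] algebra_simps)
  ultimately show ?thesis by simp
qed

text \<open>
  Conditioning on \<open>B t \<subseteq> W\<close> replaces \<open>W\<close> by \<open>W \<union> B t\<close>; the sets meeting \<open>B t\<close> are then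
  decoupled from those disjoint from it by Harris' inequality.
\<close>

lemma laplace_conditional:
  assumes "t \<in> I" "0 \<le> s"
  shows "p ^ card (B t) * laplace s
      - s * laplace s * (\<Sum>u\<in>{u \<in> I. B t \<inter> B u \<noteq> {}}. w u * p ^ card (B t \<union> B u))
    \<le> \<E> (\<lambda>W. of_bool (B t \<subseteq> W) * exp (- (s * count W)))"
proof -
  let ?N = "{u \<in> I. B t \<inter> B u \<noteq> {}}" and ?D = "{u \<in> I. B t \<inter> B u = {}}"
  \<comment> \<open>\<open>Y\<close> collects the sets meeting \<open>B t\<close>: once
    \<open>B t\<close> is added to the sample, only \<open>B u - B t\<close> still has to be
    sampled. Sets disjoint from \<open>B t\<close>, collected in \<open>Y'\<close>, are
    unaffected.\<close>
  define Y where "Y W = (\<Sum>u\<in>?N. w u * of_bool (B u - B t \<subseteq> W))" for W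
  define Y' where "Y' W = (\<Sum>u\<in>?D. w u * of_bool (B u \<subseteq> W))" for W
  have split: "count (W \<union> B t) = Y W + Y' W" for W
  proof -
    have "count (W \<union> B t) = (\<Sum>u\<in>?N. w u * of_bool (B u \<subseteq> W \<union> B t)) + (\<Sum>u\<in>?D. w u * of_bool (B u \<subseteq> W \<union> B t))"
      unfolding count_def using finite_index
      by (subst sum.union_disjoint[symmetric]) (auto intro: sum.cong)
    also have "(\<Sum>u\<in>?N. w u * of_bool (B u \<subseteq> W \<union> B t)) = Y W"
      unfolding Y_def by (intro sum.cong refl arg_cong2[where f="(*)"] arg_cong[where f=of_bool]) auto
    also have "(\<Sum>u\<in>?D. w u * of_bool (B u \<subseteq> W \<union> B t)) = Y' W"
      unfolding Y'_def by (intro sum.cong refl arg_cong2[where f="(*)"] arg_cong[where f=of_bool]) auto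
    finally show ?thesis .
  qed
  have Y_mono: "Y V \<le> Y W" if "V \<subseteq> W" for V W
    unfolding Y_def using that w_nonneg by (intro sum_mono mult_left_mono) auto
  have Y'_mono: "Y' V \<le> Y' W" if "V \<subseteq> W" for V W
    unfolding Y'_def using that w_nonneg by (intro sum_mono mult_left_mono) auto
  have Y'_le: "Y' W \<le> count W" for W
    unfolding Y'_def count_def using finite_index w_nonneg by (intro sum_mono2) auto
  have "\<E> Y = (\<Sum>u\<in>?N. w u * p ^ card (B u - B t))"
    unfolding Y_def[abs_def] using B_subset finite_ground p
    by (simp add: integ) (intro sum.cong refl, subst subset_mean_superset_1; auto)
  moreover have "card (B t) + card (B u - B t) = card (B t \<union> B u)" if "u \<in> I" for u
    using that assms B_subset finite_ground
    by (metis card_Un_disjoint Diff_disjoint Un_Diff_cancel finite_Diff finite_subset)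
  ultimately have EY: "p ^ card (B t) * \<E> Y = (\<Sum>u\<in>?N. w u * p ^ card (B t \<union> B u))"
    by (auto simp: sum_distrib_left power_add[symmetric] mult.left_commute intro!: sum.cong)
  \<comment> \<open>\<open>Y\<close> is handled by \<open>1 - x \<le> exp (- x)\<close> and
    \<open>Y'\<close> by \<open>Y' \<le> count\<close>; Harris' inequality joins the two
    factors.\<close>
  have "(1 - s * \<E> Y) * laplace s \<le> \<E> (\<lambda>W. exp (- (s * Y W))) * laplace s"
  proof (rule mult_right_mono)
    have "1 - s * \<E> Y = \<E> (\<lambda>W. 1 - s * Y W)"
      by (simp add: integ)
    also have "\<dots> \<le> \<E> (\<lambda>W. exp (- (s * Y W)))"
      using exp_ge_add_one_self[of "- (s * Y _)"] by (intro subset_mean_mono finite_ground) auto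
    finally show "1 - s * \<E> Y \<le> \<E> (\<lambda>W. exp (- (s * Y W)))" .
    show "0 \<le> laplace s" by (simp add: laplace_def)
  qed
  also have "\<dots> \<le> \<E> (\<lambda>W. exp (- (s * Y W))) * \<E> (\<lambda>W. exp (- (s * Y' W)))"
    unfolding laplace_def using assms Y'_le
    by (intro mult_left_mono subset_mean_mono finite_ground) (auto intro: mult_left_mono)
  also have "\<dots> \<le> \<E> (\<lambda>W. exp (- (s * Y W)) * exp (- (s * Y' W)))"
    using assms p by (intro subset_mean_harris finite_ground) (auto intro!: mult_left_mono Y_mono Y'_mono)
  also have "\<dots> = \<E> (\<lambda>W. exp (- (s * count (W \<union> B t))))"
    by (simp add: split exp_add[symmetric] algebra_simps)
  finally have "p ^ card (B t) * ((1 - s * \<E> Y) * laplace s) \<le> p ^ card (B t) * \<dots>"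
    using p by (intro mult_left_mono) auto
  also have "\<dots> = \<E> (\<lambda>W. of_bool (B t \<subseteq> W) * exp (- (s * count W)))"
    using subset_mean_superset[OF finite_ground p, of "B t" "\<lambda>W. exp (- (s * count W))"] assms B_subset
    by simp
  finally show ?thesis
    unfolding EY[symmetric] by (simp add: algebra_simps)
qed

lemma laplace_le:
  assumes "0 \<le> s"
  shows "laplace s \<le> exp (- (s * expected_count) + s\<^sup>2 * overlap / 2)"
proof -
  \<comment> \<open>The claim amounts to \<open>G s \<le> 1 = G 0\<close>, so it suffices that
    \<open>G\<close> does not increase.\<close>
  define G where "G s = laplace s * exp (s * expected_count - s\<^sup>2 * overlap / 2)" for s
  have "G s \<le> G 0"
  proof (rule DERIV_nonpos_imp_nonincreasing[OF assms])
    fix r :: real assume "0 \<le> r" "r \<le> s"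
    define L where "L = (\<Sum>t\<in>I. w t * \<E> (\<lambda>W. of_bool (B t \<subseteq> W) * exp (- (r * count W))))"
    let ?e = "exp (r * expected_count - r\<^sup>2 * overlap / 2)"
    have D: "(G has_real_derivative (- L + laplace r * (expected_count - r * overlap)) * ?e) (at r)"
      unfolding G_def[abs_def] L_def
      by (rule derivative_eq_intros laplace_deriv refl | simp add: algebra_simps)+
    \<comment> \<open>Summing \<open>laplace_conditional\<close> over \<open>t\<close> with weights
      \<open>w t\<close> gives exactly the sign of the derivative.\<close>
    have "laplace r * (expected_count - r * overlap) = (\<Sum>t\<in>I. w t * (p ^ card (B t) * laplace r
      - r * laplace r * (\<Sum>u\<in>{u \<in> I. B t \<inter> B u \<noteq> {}}. w u * p ^ card (B t \<union> B u))))"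
      by (simp add: expected_count_def overlap_def sum_distrib_left sum_subtractf algebra_simps)
    also have "\<dots> \<le> L"
      unfolding L_def using w_nonneg \<open>0 \<le> r\<close> by (intro sum_mono mult_left_mono laplace_conditional) auto
    finally have "(- L + laplace r * (expected_count - r * overlap)) * ?e \<le> 0"
      by (intro mult_nonpos_nonneg) auto
    with D show "\<exists>y. (G has_real_derivative y) (at r) \<and> y \<le> 0" by blast
  qed
  also have "G 0 = 1" by (simp add: G_def laplace_def)
  finally have "laplace s * exp (s * expected_count - s\<^sup>2 * overlap / 2) \<le> 1" by (simp add: G_def)
  then have "laplace s \<le> 1 / exp (s * expected_count - s\<^sup>2 * overlap / 2)"
    by (simp add: pos_le_divide_eq)
  then show ?thesis by (simp add: exp_minus[symmetric] inverse_eq_divide[symmetric])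
qed

text \<open>Janson's inequality with weights.\<close>

lemma lower_tail:
  assumes "0 < d" "overlap \<le> \<Delta>" "0 < \<Delta>"
  shows "measure_pmf.prob (random_subset A p) {W. count W \<le> expected_count - d} \<le> exp (- d\<^sup>2 / (2 * \<Delta>))"
proof -
  \<comment> \<open>This \<open>s\<close> minimises the exponent
    \<open>s\<^sup>2 * \<Delta> / 2 - s * d\<close>. The positive bound \<open>\<Delta>\<close>
    stands in for \<open>overlap\<close>, which may be zero.\<close>
  define s where "s = d / \<Delta>"
  have s: "0 \<le> s" using assms by (simp add: s_def)
  have "measure_pmf.prob (random_subset A p) {W. count W \<le> expected_count - d}
      = \<E> (indicator {W. count W \<le> expected_count - d})"
    by simp
  also have "\<dots> \<le> \<E> (\<lambda>W. exp (- (s * count W)) * exp (s * (expected_count - d)))"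
  proof (rule subset_mean_mono[OF finite_ground])
    show "indicator {W. count W \<le> expected_count - d} W
        \<le> exp (- (s * count W)) * exp (s * (expected_count - d))" for W
      using s mult_left_mono[of "count W" "expected_count - d" s]
      by (auto simp: indicator_def exp_add[symmetric])
  qed
  also have "\<dots> = laplace s * exp (s * (expected_count - d))"
    by (simp add: laplace_def)
  also have "\<dots> \<le> exp (- (s * expected_count) + s\<^sup>2 * overlap / 2) * exp (s * (expected_count - d))"
    using laplace_le[OF s] by (intro mult_right_mono) auto
  also have "\<dots> = exp (s\<^sup>2 * overlap / 2 - s * d)"
    by (simp add: exp_add[symmetric] algebra_simps)
  also have "\<dots> \<le> exp (s\<^sup>2 * \<Delta> / 2 - s * d)"
    using assms by (auto intro: mult_left_mono)
  also have "s\<^sup>2 * \<Delta> / 2 - s * d = - d\<^sup>2 / (2 * \<Delta>)"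
    using assms by (simp add: s_def field_simps power2_eq_square)
  finally show ?thesis .
qed

end

section \<open>Gaps in the degree sequence\<close>

text \<open>
  The bound is that of a parking process: each point of \<open>Q\<close> parks at the largest free position
  \<open>\<le> f v\<close>, and the positions \<open>L\<close> below are those that end up occupied.
\<close>

lemma card_crowded_levels:
  fixes f :: "'b \<Rightarrow> nat"
  assumes "finite Q"
  defines "C \<equiv> \<lambda>Q. {L. \<exists>b\<ge>1. b \<le> card {v \<in> Q. L \<le> f v \<and> f v < L + b}}"
  shows "finite (C Q) \<and> card (C Q) \<le> card Q"
proof -
  have C_iff: "L \<in> C Q \<longleftrightarrow> (\<exists>b\<ge>1. b \<le> card {v \<in> Q. L \<le> f v \<and> f v < L + b})" for L Q
    by (simp add: C_def)
  have C_empty: "C {} = {}" by (auto simp: C_def)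
  show ?thesis
    using assms(1)
  proof (induction Q rule: finite_induct)
    case empty
    then show ?case by (simp add: C_empty)
  next
    case (insert u Q)
    let ?N = "\<lambda>Q L b. card {v \<in> Q. L \<le> f v \<and> f v < L + b}"
    have add: "?N (insert u Q) L b = ?N Q L b + of_bool (L \<le> f u \<and> f u < L + b)" for L b
    proof -
      have "{v \<in> insert u Q. L \<le> f v \<and> f v < L + b}
        = (if L \<le> f u \<and> f u < L + b then insert u {v \<in> Q. L \<le> f v \<and> f v < L + b}
           else {v \<in> Q. L \<le> f v \<and> f v < L + b})"
        by auto
      then show ?thesis using insert by simp
    qed
    \<comment> \<open>A level that is crowded only because of \<open>u\<close> has a window that
      contains \<open>f u\<close> and was exactly one point short.\<close>
    have new: "\<exists>b. b \<ge> 1 \<and> ?N Q L b = b - 1 \<and> L \<le> f u \<and> f u < L + b" if "L \<in> C (insert u Q) - C Q" for L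
    proof -
      have L: "L \<in> C (insert u Q)" "L \<notin> C Q" using that by auto
      obtain b where b: "b \<ge> 1" "b \<le> ?N (insert u Q) L b" using L(1)[unfolded C_iff] by (elim exE conjE)
      have "\<not> b \<le> ?N Q L b" using L(2)[unfolded C_iff] b(1) by simp
      then have "?N Q L b = b - 1 \<and> L \<le> f u \<and> f u < L + b"
        using b(2) unfolding add by (simp split: if_splits add: of_bool_def)
      then show ?thesis using b(1) by blast
    qed
    \<comment> \<open>If \<open>L < L'\<close> were both new, then \<open>[L, L')\<close> holds
      fewer than \<open>L' - L\<close> points of \<open>Q\<close>, as \<open>L\<close> was not
      crowded by \<open>Q\<close>. The rest of the window of \<open>L\<close> would then already
      crowd \<open>L'\<close>.\<close>
    have not_less: "\<not> L < L'" if L: "L \<in> C (insert u Q) - C Q" and L': "L' \<in> C (insert u Q) - C Q" for L L'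
    proof
      assume less: "L < L'"
      obtain b where b: "b \<ge> 1" "?N Q L b = b - 1" "f u < L + b" using new[OF L] by blast
      have "L' \<le> f u" using new[OF L'] by blast
      \<comment> \<open>Length of the window that starts at \<open>L'\<close> and ends where that of
        \<open>L\<close> ends; it is positive because \<open>L' \<le> f u < L + b\<close>.\<close>
      define b' where "b' = L + b - L'"
      have b': "b' \<ge> 1" "L' + b' = L + b" using \<open>L' \<le> f u\<close> b less by (auto simp: b'_def)
      have "?N Q L b = ?N Q L (L' - L) + ?N Q L' b'"
        using insert(1) less b'
        by (subst card_Un_disjoint[symmetric]) (auto intro!: arg_cong[where f = card])
      moreover have "\<not> L' - L \<le> ?N Q L (L' - L)"
      proof
        assume "L' - L \<le> ?N Q L (L' - L)"
        then have "L \<in> C Q" unfolding C_iff using less by (intro exI[of _ "L' - L"]) simp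
        then show False using L by blast
      qed
      ultimately have "b' \<le> ?N Q L' b'" using b b' less by linarith
      then have "L' \<in> C Q" unfolding C_iff using b'(1) by (intro exI[of _ b']) simp
      then show False using L' by blast
    qed
    have "\<exists>L0. C (insert u Q) - C Q \<subseteq> {L0}"
      using not_less by (metis insertCI linorder_neqE_nat subsetI)
    then obtain L0 where "C (insert u Q) \<subseteq> insert L0 (C Q)" by blast
    then have "finite (C (insert u Q)) \<and> card (C (insert u Q)) \<le> card (insert L0 (C Q))"
      using insert.IH by (meson card_mono finite_insert finite_subset)
    moreover have "card (insert L0 (C Q)) \<le> Suc (card (C Q))"
      using insert.IH by (simp add: card_insert_if)
    ultimately show ?case using insert by simp
  qed
qed

text \<open>The bad levels: some \<open>b\<close>-th largest degree among those at most
  \<open>\<beta> ^ L\<close> exceeds \<open>\<beta> ^ (L + b)\<close>. The window form is the one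
  that the parking bound counts.\<close>

definition crowded :: "('b \<Rightarrow> real) \<Rightarrow> real \<Rightarrow> 'b set \<Rightarrow> nat \<Rightarrow> bool" where
  "crowded d \<beta> Q L \<longleftrightarrow> (\<exists>b\<ge>1. b \<le> card {v \<in> Q. \<beta> ^ (L + b) < d v \<and> d v \<le> \<beta> ^ L})"

text \<open>Reduction to integers: with \<open>f v\<close> the last level such that
  \<open>d v \<le> \<beta> ^ L\<close>, windows of degrees become windows of levels.\<close>

lemma card_crowded:
  fixes \<beta> :: real
  assumes "finite Q" "0 < \<beta>" "\<beta> < 1" "\<And>v. v \<in> Q \<Longrightarrow> 0 < d v \<and> d v \<le> 1"
  shows "card {L. L \<le> m \<and> crowded d \<beta> Q L} \<le> card Q"
proof -
  have "\<exists>l. \<forall>L. d v \<le> \<beta> ^ L \<longleftrightarrow> L \<le> l" if v: "v \<in> Q" for v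
  proof -
    \<comment> \<open>Such an \<open>l\<close> exists because \<open>0 < d v\<close>, and is
      positive because \<open>d v \<le> 1\<close>, so \<open>l - 1\<close> is a true
      predecessor.\<close>
    define l where "l = (LEAST l. \<beta> ^ l < d v)"
    have ex: "\<exists>l. \<beta> ^ l < d v" using real_arch_pow_inv[of "d v" \<beta>] assms v by blast
    have l: "\<beta> ^ l < d v" unfolding l_def using ex by (rule LeastI_ex)
    have l0: "l \<noteq> 0" using l assms(4)[OF v] by (intro notI) simp
    have "d v \<le> \<beta> ^ L \<longleftrightarrow> L \<le> l - 1" for L
    proof
      assume "d v \<le> \<beta> ^ L"
      then have "\<not> l \<le> L" using l power_decreasing[of l L \<beta>] assms by fastforce
      then show "L \<le> l - 1" by simp
    next
      assume "L \<le> l - 1"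
      then have "L < l" using l0 by simp
      then show "d v \<le> \<beta> ^ L" unfolding l_def using not_less_Least by force
    qed
    then show ?thesis by blast
  qed
  then obtain f where f: "\<And>v L. v \<in> Q \<Longrightarrow> d v \<le> \<beta> ^ L \<longleftrightarrow> L \<le> f v" by metis
  have "{v \<in> Q. \<beta> ^ (L + b) < d v \<and> d v \<le> \<beta> ^ L} = {v \<in> Q. L \<le> f v \<and> f v < L + b}" for L b
    using f by (auto simp: not_le[symmetric])
  then have "{L. L \<le> m \<and> crowded d \<beta> Q L} \<subseteq> {L. \<exists>b\<ge>1. b \<le> card {v \<in> Q. L \<le> f v \<and> f v < L + b}}"
    unfolding crowded_def by auto
  then show ?thesis using card_crowded_levels[OF assms(1), of f] by (meson card_mono le_trans)
qed

text \<open>Otherwise \<open>S\<close> itself would fill the window with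
  \<open>b = card S\<close>.\<close>

lemma not_crowded_imp_small:
  assumes "finite Q" "\<not> crowded d \<beta> Q L" "S \<subseteq> Q" "S \<noteq> {}" "\<And>v. v \<in> S \<Longrightarrow> d v \<le> \<beta> ^ L"
  shows "\<exists>v\<in>S. d v \<le> \<beta> ^ (L + card S)"
proof (rule ccontr)
  assume "\<not> ?thesis"
  then have "S \<subseteq> {v \<in> Q. \<beta> ^ (L + card S) < d v \<and> d v \<le> \<beta> ^ L}" using assms by force
  then have "card S \<le> card {v \<in> Q. \<beta> ^ (L + card S) < d v \<and> d v \<le> \<beta> ^ L}"
    using assms(1) by (intro card_mono) auto
  moreover have "1 \<le> card S" using assms finite_subset by (metis card_0_eq less_one not_le)
  ultimately show False using assms(2) unfolding crowded_def by blast
qed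

section \<open>From a nonadaptive tester to a sample-based tester\<close>

locale query_tester =
  fixes n q :: nat and T :: "'a tester" and c p :: real
  assumes nonadaptive: "nonadaptive_tester n T" and max_queries: "max_queries T \<le> q"
    and c: "0 < c" "c < 1" and p: "0 < p" "p \<le> 1"
begin

abbreviation "supp \<equiv> set_pmf (test_dist T)"
abbreviation "\<mu> \<equiv> pmf (test_dist T)"
abbreviation "\<beta> \<equiv> c * p"

definition degree :: "nat \<Rightarrow> real" where
  "degree v = measure_pmf.prob (test_dist T) {t. v \<in> queries t}"

definition kernel :: "nat \<Rightarrow> nat set" where
  "kernel L = {v \<in> {1..n}. \<beta> ^ L < degree v}"

definition petals :: "nat \<Rightarrow> 'a local_test \<Rightarrow> nat set" where
  "petals L t = queries t - kernel L"

definition gapped :: "nat \<Rightarrow> 'a local_test set" where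
  "gapped L = {t \<in> supp. \<not> crowded degree \<beta> (queries t) L}"

definition rejecting :: "nat \<Rightarrow> (nat \<Rightarrow> 'a) \<Rightarrow> 'a local_test set" where
  "rejecting L z = {t \<in> gapped L. rejects t (restrict z (queries t))}"

text \<open>Inverse probability weighting: the petals of \<open>t\<close> are all sampled with
  probability \<open>p ^ card (petals L t)\<close>, so the sampled weight of \<open>t\<close> has
  mean \<open>\<mu> t\<close>.\<close>

definition weight :: "nat \<Rightarrow> 'a local_test \<Rightarrow> real" where
  "weight L t = \<mu> t / p ^ card (petals L t)"

lemma beta: "0 < \<beta>" "\<beta> < 1"
  using c p mult_strict_mono'[of c 1 p 1] mult_less_cancel_left_pos[of c p 1]
  by (auto simp: mult_le_one) (smt (verit) mult_left_le)

lemma finite_supp: "finite supp"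
  using nonadaptive unfolding nonadaptive_tester_def by (blast intro: finite_subset)

lemma queries_subset: "t \<in> supp \<Longrightarrow> queries t \<subseteq> {1..n}"
  using nonadaptive unfolding nonadaptive_tester_def by blast

lemma finite_queries: "t \<in> supp \<Longrightarrow> finite (queries t)"
  using queries_subset finite_subset by blast

lemma card_queries: "t \<in> supp \<Longrightarrow> card (queries t) \<le> q"
  using Max_ge[of "(\<lambda>t. card (queries t)) ` supp" "card (queries t)"] finite_supp
    order_trans[OF _ max_queries[unfolded max_queries_def]]
  by blast

section \<open>Degrees, kernel size and choice of the level\<close>

lemma prob_eq: "measure_pmf.prob (test_dist T) X = (\<Sum>t\<in>supp. \<mu> t * of_bool (t \<in> X))"
proof -
  have "measure_pmf.prob (test_dist T) X = sum \<mu> (X \<inter> supp)"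
    using finite_supp by (metis finite_Int measure_Int_set_pmf measure_measure_pmf_finite)
  also have "\<dots> = (\<Sum>t\<in>supp. \<mu> t * of_bool (t \<in> X))"
    using finite_supp by (simp add: of_bool_def sum.If_cases Int_commute if_distrib cong: if_cong)
  finally show ?thesis .
qed

lemma sum_mu: "sum \<mu> supp = 1"
  using finite_supp by (simp add: sum_pmf_eq_1)

lemma degree_pos: "t \<in> supp \<Longrightarrow> v \<in> queries t \<Longrightarrow> 0 < degree v"
  unfolding degree_def by (rule measure_pmf_posI) auto

lemma degree_le_1: "degree v \<le> 1"
  by (simp add: degree_def)

text \<open>Double counting: exchanging the sums counts the queries of each test.\<close>

lemma sum_degree: "(\<Sum>v\<in>{1..n}. degree v) \<le> q"
proof -
  have "(\<Sum>v\<in>{1..n}. degree v) = (\<Sum>t\<in>supp. \<mu> t * (\<Sum>v\<in>{1..n}. of_bool (v \<in> queries t)))"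
    unfolding degree_def prob_eq by (subst sum.swap) (simp add: sum_distrib_left del: sum_mult_of_bool_eq sum_of_bool_eq)
  also have "\<dots> \<le> (\<Sum>t\<in>supp. \<mu> t * q)"
  proof (intro sum_mono mult_left_mono)
    fix t assume t: "t \<in> supp"
    have "(\<Sum>v\<in>{1..n}. of_bool (v \<in> queries t) :: real) = card (queries t)"
      using queries_subset[OF t] by (simp add: of_bool_def sum.If_cases Int_absorb1)
    then show "(\<Sum>v\<in>{1..n}. of_bool (v \<in> queries t)) \<le> real q" using card_queries[OF t] by simp
  qed simp
  also have "\<dots> = q" by (simp add: sum_distrib_right[symmetric] sum_mu)
  finally show ?thesis .
qed

lemma card_kernel: "real (card (kernel L)) * \<beta> ^ L \<le> q"
proof -
  have "real (card (kernel L)) * \<beta> ^ L \<le> (\<Sum>v\<in>kernel L. degree v)"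
    by (rule sum_bounded_below[where K = "\<beta> ^ L", simplified]) (auto simp: kernel_def)
  also have "\<dots> \<le> (\<Sum>v\<in>{1..n}. degree v)"
    by (intro sum_mono2) (auto simp: kernel_def degree_def)
  finally show ?thesis using sum_degree by simp
qed

text \<open>Averaging: a random test has at most \<open>q\<close> crowded levels, spread over
  \<open>m + 1\<close> candidates.\<close>

lemma exists_level:
  "\<exists>L\<le>m. measure_pmf.prob (test_dist T) {t. crowded degree \<beta> (queries t) L} \<le> q / (real m + 1)"
proof (rule ccontr)
  let ?bad = "\<lambda>L. measure_pmf.prob (test_dist T) {t. crowded degree \<beta> (queries t) L}"
  assume "\<not> ?thesis"
  then have "\<And>L. L \<le> m \<Longrightarrow> q / (real m + 1) < ?bad L"
    by (meson not_le)
  then have "(\<Sum>L\<le>m. q / (real m + 1)) < (\<Sum>L\<le>m. ?bad L)"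
    by (intro sum_strict_mono) auto
  also have "(\<Sum>L\<le>m. q / (real m + 1)) = q" by (simp add: field_simps)
  finally have "q < (\<Sum>L\<le>m. ?bad L)" .
  also have "(\<Sum>L\<le>m. ?bad L) = (\<Sum>t\<in>supp. \<mu> t * (\<Sum>L\<le>m. of_bool (crowded degree \<beta> (queries t) L)))"
    unfolding prob_eq
    by (subst sum.swap) (simp add: sum_distrib_left del: sum_mult_of_bool_eq sum_of_bool_eq)
  also have "\<dots> \<le> (\<Sum>t\<in>supp. \<mu> t * q)"
  proof (intro sum_mono mult_left_mono)
    fix t assume t: "t \<in> supp"
    have "(\<Sum>L\<le>m. of_bool (crowded degree \<beta> (queries t) L) :: real)
        = card {L. L \<le> m \<and> crowded degree \<beta> (queries t) L}"
      by (simp add: of_bool_def sum.If_cases Int_def)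
    also have "\<dots> \<le> card (queries t)"
      using card_crowded[OF finite_queries[OF t] beta] degree_pos[OF t] degree_le_1 by simp
    finally show "(\<Sum>L\<le>m. of_bool (crowded degree \<beta> (queries t) L)) \<le> real q"
      using card_queries[OF t] by simp
  qed simp
  also have "\<dots> = q" by (simp add: sum_distrib_right[symmetric] sum_mu)
  finally show False by simp
qed

section \<open>Mean and overlap of the rejecting tests\<close>

lemma reject_prob_eq: "reject_prob T z = (\<Sum>t\<in>supp. \<mu> t * of_bool (rejects t (restrict z (queries t))))"
  using nonadaptive unfolding reject_prob_def prob_eq nonadaptive_tester_def by (intro sum.cong) auto

lemma sum_rejecting:
  "sum \<mu> (rejecting L z)
    = (\<Sum>t\<in>supp. \<mu> t * of_bool (\<not> crowded degree \<beta> (queries t) L \<and> rejects t (restrict z (queries t))))"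
  using finite_supp
  by (auto simp: rejecting_def gapped_def intro!: sum.mono_neutral_cong_left)

lemma sum_rejecting_le: "sum \<mu> (rejecting L z) \<le> reject_prob T z"
  unfolding sum_rejecting reject_prob_eq by (intro sum_mono mult_left_mono) auto

text \<open>Discarding the crowded tests costs at most their total probability.\<close>

lemma sum_rejecting_ge:
  "reject_prob T z - measure_pmf.prob (test_dist T) {t. crowded degree \<beta> (queries t) L}
    \<le> sum \<mu> (rejecting L z)"
  unfolding sum_rejecting reject_prob_eq prob_eq sum_subtractf[symmetric] right_diff_distrib[symmetric]
  by (intro sum_mono mult_left_mono) auto

lemma rejecting_subset: "rejecting L z \<subseteq> supp"
  by (auto simp: rejecting_def gapped_def)

lemma subset_count_rejecting: "subset_count {1..n} p (rejecting L z) (weight L) (petals L)"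
proof
  show "finite (rejecting L z)" using finite_supp rejecting_subset by (rule finite_subset[rotated])
  show "petals L t \<subseteq> {1..n}" if "t \<in> rejecting L z" for t
    using that rejecting_subset queries_subset unfolding petals_def by blast
qed (use p in \<open>auto simp: weight_def\<close>)

lemma expected_count_eq: "subset_count.expected_count p (rejecting L z) (weight L) (petals L) = sum \<mu> (rejecting L z)"
  using p by (simp add: subset_count.expected_count_def[OF subset_count_rejecting] weight_def)

text \<open>
  A nonempty set \<open>S\<close> of petals of a gapped test has an element of degree at most
  \<open>\<beta> ^ (L + card S)\<close>, so the tests meeting the petals exactly in \<open>S\<close> contribute at most
  \<open>\<beta> ^ (L + card S) / p ^ card S = c ^ card S * \<beta> ^ L\<close>.
\<close>

lemma overlap_le: "subset_count.overlap p (rejecting L z) (weight L) (petals L) \<le> 2 ^ q * c * \<beta> ^ L"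
proof -
  let ?R = "rejecting L z" and ?A = "petals L"
  have fin: "finite ?R" and finA: "\<And>t. t \<in> supp \<Longrightarrow> finite (?A t)"
    using finite_supp rejecting_subset finite_queries by (auto intro: finite_subset simp: petals_def)
  \<comment> \<open>By \<open>summand\<close> below, the weights cancel all powers of
    \<open>p\<close> but that of the intersection, so it suffices to bound the sum over
    \<open>u\<close> for each fixed \<open>t\<close>.\<close>
  have inner: "(\<Sum>u\<in>{u \<in> ?R. ?A t \<inter> ?A u \<noteq> {}}. \<mu> u / p ^ card (?A t \<inter> ?A u)) \<le> 2 ^ q * c * \<beta> ^ L"
    if t: "t \<in> ?R" for t
  proof -
    have ts: "t \<in> supp" using t rejecting_subset by blast
    let ?N = "{u \<in> ?R. ?A t \<inter> ?A u \<noteq> {}}" and ?Q = "Pow (?A t) - {{}}"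
    have finQ: "finite ?Q" using finA[OF ts] by simp
    have "(\<Sum>u\<in>?N. \<mu> u / p ^ card (?A t \<inter> ?A u))
        = (\<Sum>S\<in>?Q. \<Sum>u\<in>{u \<in> ?N. ?A t \<inter> ?A u = S}. \<mu> u / p ^ card (?A t \<inter> ?A u))"
      using fin finQ by (intro sum.group[symmetric]) auto
    also have "\<dots> \<le> (\<Sum>S\<in>?Q. c * \<beta> ^ L)"
    proof (rule sum_mono)
      fix S assume S: "S \<in> ?Q"
      have "\<And>v. v \<in> S \<Longrightarrow> degree v \<le> \<beta> ^ L"
        using S queries_subset[OF ts] by (fastforce simp: petals_def kernel_def)
      moreover have "\<not> crowded degree \<beta> (queries t) L" using t by (simp add: rejecting_def gapped_def)
      ultimately obtain v where v: "v \<in> S" "degree v \<le> \<beta> ^ (L + card S)"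
        using not_crowded_imp_small[OF finite_queries[OF ts], of degree \<beta> L S] S
        by (auto simp: petals_def)
      have "(\<Sum>u\<in>{u \<in> ?N. ?A t \<inter> ?A u = S}. \<mu> u / p ^ card (?A t \<inter> ?A u))
          = sum \<mu> {u \<in> ?N. ?A t \<inter> ?A u = S} / p ^ card S"
        by (simp add: sum_divide_distrib)
      \<comment> \<open>Every test in the group queries \<open>v\<close>.\<close>
      also have "sum \<mu> {u \<in> ?N. ?A t \<inter> ?A u = S} \<le> degree v"
      proof -
        have "sum \<mu> {u \<in> ?N. ?A t \<inter> ?A u = S}
            = measure_pmf.prob (test_dist T) {u \<in> ?N. ?A t \<inter> ?A u = S}"
          using fin by (simp add: measure_measure_pmf_finite)
        also have "\<dots> \<le> degree v"
          unfolding degree_def using v(1) by (intro measure_pmf.finite_measure_mono) (auto simp: petals_def)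
        finally show ?thesis .
      qed
      also have "degree v / p ^ card S \<le> \<beta> ^ (L + card S) / p ^ card S"
        using v(2) p by (intro divide_right_mono) auto
      also have "\<dots> = c ^ card S * \<beta> ^ L"
        using p by (simp add: power_add power_mult_distrib)
      also have "c ^ card S \<le> c"
      \<comment> \<open>Nonemptiness of \<open>S\<close> supplies the factor \<open>c\<close> that
        makes the overlap small.\<close>
      proof -
        have "finite S" using S finA[OF ts] finite_subset by blast
        then have "card S \<ge> 1" using S by (simp add: Suc_leI card_gt_0_iff)
        then show ?thesis using c power_decreasing[of 1 "card S" c] by simp
      qed
      finally show "(\<Sum>u\<in>{u \<in> ?N. ?A t \<inter> ?A u = S}. \<mu> u / p ^ card (?A t \<inter> ?A u)) \<le> c * \<beta> ^ L"
        using beta p by (simp add: divide_right_mono mult_right_mono)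
    qed
    also have "\<dots> = card ?Q * (c * \<beta> ^ L)" by simp
    also have "\<dots> \<le> 2 ^ q * (c * \<beta> ^ L)"
    proof (rule mult_right_mono)
      have "card ?Q \<le> card (Pow (?A t))" using finA[OF ts] by (intro card_mono) auto
      also have "\<dots> = 2 ^ card (?A t)" using finA[OF ts] by (simp add: card_Pow)
      also have "card (?A t) \<le> card (queries t)"
        using finite_queries[OF ts] by (intro card_mono) (auto simp: petals_def)
      also have "\<dots> \<le> q" by (rule card_queries[OF ts])
      finally have "card ?Q \<le> 2 ^ q" by simp
      then show "real (card ?Q) \<le> 2 ^ q" by (metis of_nat_le_iff of_nat_numeral of_nat_power)
    qed (use c beta in auto)
    finally show ?thesis by (simp add: mult.assoc)
  qed
  have summand: "weight L t * weight L u * p ^ card (?A t \<union> ?A u) = \<mu> t * (\<mu> u / p ^ card (?A t \<inter> ?A u))"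
    if "t \<in> ?R" "u \<in> ?R" for t u
  proof -
    have "card (?A t) + card (?A u) = card (?A t \<union> ?A u) + card (?A t \<inter> ?A u)"
      using that rejecting_subset by (intro card_Un_Int finA) auto
    then have "p ^ card (?A t) * p ^ card (?A u) = p ^ card (?A t \<union> ?A u) * p ^ card (?A t \<inter> ?A u)"
      by (metis power_add)
    then show ?thesis using p by (simp add: weight_def field_simps)
  qed
  have "subset_count.overlap p ?R (weight L) ?A
      = (\<Sum>t\<in>?R. \<mu> t * (\<Sum>u\<in>{u \<in> ?R. ?A t \<inter> ?A u \<noteq> {}}. \<mu> u / p ^ card (?A t \<inter> ?A u)))"
    unfolding subset_count.overlap_def[OF subset_count_rejecting] sum_distrib_left
    by (intro sum.cong refl) (simp add: summand)
  also have "\<dots> \<le> (\<Sum>t\<in>?R. \<mu> t * (2 ^ q * c * \<beta> ^ L))"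
    by (intro sum_mono mult_left_mono inner) auto
  also have "\<dots> \<le> (\<Sum>t\<in>supp. \<mu> t * (2 ^ q * c * \<beta> ^ L))"
    using finite_supp rejecting_subset c beta by (intro sum_mono2) auto
  also have "\<dots> = 2 ^ q * c * \<beta> ^ L" by (simp add: sum_distrib_right[symmetric] sum_mu)
  finally show ?thesis .
qed

section \<open>The kernel sampler and its error probabilities\<close>

definition patch :: "nat \<Rightarrow> (nat \<Rightarrow> 'a) \<Rightarrow> (nat \<Rightarrow> 'a) \<Rightarrow> nat \<Rightarrow> 'a" where
  "patch L h x = (\<lambda>v. if v \<in> kernel L then h v else x v)"

text \<open>\<open>y\<close> is the sampled subword. On the kernel the guess \<open>h\<close>
  overrides even sampled values, so the randomness enters only through the petals.\<close>

definition estimate :: "nat \<Rightarrow> nat set \<Rightarrow> (nat \<Rightarrow> 'a) \<Rightarrow> (nat \<Rightarrow> 'a) \<Rightarrow> real" where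
  "estimate L W y h = (\<Sum>t\<in>rejecting L (patch L h y). weight L t * of_bool (petals L t \<subseteq> W))"

definition kernel_sampler :: "'a set \<Rightarrow> nat \<Rightarrow> real \<Rightarrow> 'a sampling_tester" where
  "kernel_sampler \<Sigma> L \<theta> = Sampling_Tester p
     (\<lambda>W y. return_pmf (\<forall>h\<in>kernel L \<rightarrow>\<^sub>E \<Sigma>. \<theta> < estimate L W y h))"

text \<open>A test with a nonzero term has all its petals in \<open>W\<close>, hence never reads the
  default values of \<open>restrict x W\<close>.\<close>

lemma estimate_eq:
  "estimate L W (restrict x W) h
    = subset_count.count (rejecting L (patch L h x)) (weight L) (petals L) W"
proof -
  have fin: "finite (gapped L)" using finite_supp by (simp add: gapped_def)
  have *: "rejects t (restrict (patch L h (restrict x W)) (queries t)) = rejects t (restrict (patch L h x) (queries t))"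
    if "petals L t \<subseteq> W" for t
  proof -
    have "restrict (patch L h (restrict x W)) (queries t) = restrict (patch L h x) (queries t)"
      using that by (auto simp: patch_def petals_def restrict_def fun_eq_iff)
    then show ?thesis by simp
  qed
  show ?thesis
    unfolding estimate_def subset_count.count_def[OF subset_count_rejecting]
    unfolding rejecting_def
    by (subst (1 2) sum.inter_filter[OF fin]) (auto intro!: sum.cong simp: *)
qed

lemma sample_reject_prob_eq:
  "sample_reject_prob n (kernel_sampler \<Sigma> L \<theta>) x = measure_pmf.prob (random_subset {1..n} p)
    {W. \<forall>h\<in>kernel L \<rightarrow>\<^sub>E \<Sigma>. \<theta> < subset_count.count (rejecting L (patch L h x)) (weight L) (petals L) W}"
  by (simp add: sample_reject_prob_def verdict_def kernel_sampler_def random_coords_eq estimate_eq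
      pmf_map map_pmf_def[symmetric] vimage_def)

lemma finite_kernel: "finite (kernel L)"
  by (simp add: kernel_def)

lemma patch_self:
  "rejecting L (patch L (restrict x (kernel L)) x) = rejecting L x"
proof -
  have "patch L (restrict x (kernel L)) x = x" by (auto simp: patch_def)
  then show ?thesis by simp
qed

text \<open>The true kernel values are among the guesses, so rejection needs their estimate, of mean
  at most \<open>\<gamma>\<close>, to exceed the threshold. The threshold lies midway between
  \<open>\<gamma>\<close> and the mean \<open>\<gamma> + \<eta>\<close> guaranteed for far
  words.\<close>

lemma kernel_sampler_member:
  assumes "x \<in> words n \<Sigma>" "reject_prob T x \<le> \<gamma>" "0 < \<eta>"
  shows "sample_reject_prob n (kernel_sampler \<Sigma> L (\<gamma> + \<eta> / 2)) x \<le> 2 ^ q * c * \<beta> ^ L / (\<eta> / 2)\<^sup>2"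
proof -
  interpret S: subset_count "{1..n}" p "rejecting L x" "weight L" "petals L"
    by (rule subset_count_rejecting)
  have h: "restrict x (kernel L) \<in> kernel L \<rightarrow>\<^sub>E \<Sigma>"
    using assms(1) by (auto simp: words_def kernel_def PiE_def Pi_def)
  have "sample_reject_prob n (kernel_sampler \<Sigma> L (\<gamma> + \<eta> / 2)) x
      \<le> measure_pmf.prob (random_subset {1..n} p) {W. S.expected_count + \<eta> / 2 < S.count W}"
    unfolding sample_reject_prob_eq
  proof (rule measure_pmf.finite_measure_mono[OF subsetI]; (unfold mem_Collect_eq)?)
    fix W
    assume "\<forall>h\<in>kernel L \<rightarrow>\<^sub>E \<Sigma>.
      \<gamma> + \<eta> / 2 < subset_count.count (rejecting L (patch L h x)) (weight L) (petals L) W"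
    from bspec[OF this h] have "\<gamma> + \<eta> / 2 < S.count W" unfolding patch_self .
    then show "S.expected_count + \<eta> / 2 < S.count W"
      using sum_rejecting_le[of L x] assms(2) by (simp add: expected_count_eq)
  qed simp
  also have "\<dots> \<le> S.overlap / (\<eta> / 2)\<^sup>2" using assms(3) by (intro S.upper_tail) simp
  also have "\<dots> \<le> 2 ^ q * c * \<beta> ^ L / (\<eta> / 2)\<^sup>2" by (intro divide_right_mono overlap_le) simp
  finally show ?thesis .
qed

text \<open>Tests in the support have positive probability, so none rejects \<open>x\<close>; the
  estimate for the true kernel values is then 0 on every sample.\<close>

lemma kernel_sampler_one_sided:
  assumes "x \<in> words n \<Sigma>" "reject_prob T x = 0" "0 \<le> \<theta>"
  shows "sample_reject_prob n (kernel_sampler \<Sigma> L \<theta>) x = 0"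
proof -
  have "rejecting L x = {}"
  proof (rule ccontr)
    assume "rejecting L x \<noteq> {}"
    then have "0 < sum \<mu> (rejecting L x)"
      using finite_supp rejecting_subset[of L x]
      by (intro sum_pos) (auto intro: finite_subset simp: pmf_positive)
    then show False using sum_rejecting_le[of L x] assms(2) by simp
  qed
  then have zero: "subset_count.count (rejecting L (patch L (restrict x (kernel L)) x)) (weight L) (petals L) W = 0" for W
    by (simp add: patch_self subset_count.count_def[OF subset_count_rejecting, of L x, unfolded \<open>rejecting L x = {}\<close>])
  have h: "restrict x (kernel L) \<in> kernel L \<rightarrow>\<^sub>E \<Sigma>"
    using assms(1) by (auto simp: words_def kernel_def PiE_def Pi_def)
  have "\<not> (\<forall>h\<in>kernel L \<rightarrow>\<^sub>E \<Sigma>.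
      \<theta> < subset_count.count (rejecting L (patch L h x)) (weight L) (petals L) W)" for W
  proof
    assume "\<forall>h\<in>kernel L \<rightarrow>\<^sub>E \<Sigma>.
      \<theta> < subset_count.count (rejecting L (patch L h x)) (weight L) (petals L) W"
    from bspec[OF this h] have "\<theta> < 0" unfolding zero .
    then show False using assms(3) by simp
  qed
  then show ?thesis unfolding sample_reject_prob_eq by (metis (no_types, lifting) Collect_empty_eq measure_empty)
qed

text \<open>For every guess the gapped tests keep mean at least \<open>\<delta> - (\<delta> -
  \<gamma> - \<eta>) = \<gamma> + \<eta>\<close>. Janson's inequality with deviation
  \<open>\<eta> / 2\<close> bounds each failure, and a union bound covers the guesses.\<close>

lemma kernel_sampler_far:
  assumes "finite \<Sigma>"
    and bad: "measure_pmf.prob (test_dist T) {t. crowded degree \<beta> (queries t) L} \<le> \<delta> - \<gamma> - \<eta>"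
    and "0 < \<eta>" and rej: "\<And>h. h \<in> kernel L \<rightarrow>\<^sub>E \<Sigma> \<Longrightarrow> \<delta> \<le> reject_prob T (patch L h x)"
  shows "1 - card \<Sigma> ^ card (kernel L) * exp (- (\<eta> / 2)\<^sup>2 / (2 * (2 ^ q * c * \<beta> ^ L)))
    \<le> sample_reject_prob n (kernel_sampler \<Sigma> L (\<gamma> + \<eta> / 2)) x"
proof -
  let ?R = "random_subset {1..n} p" and ?H = "kernel L \<rightarrow>\<^sub>E \<Sigma>" and ?\<theta> = "\<gamma> + \<eta> / 2"
  let ?Z = "\<lambda>h. subset_count.count (rejecting L (patch L h x)) (weight L) (petals L)"
  let ?e = "exp (- (\<eta> / 2)\<^sup>2 / (2 * (2 ^ q * c * \<beta> ^ L)))"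
  have tail: "measure_pmf.prob ?R {W. ?Z h W \<le> ?\<theta>} \<le> ?e" if h: "h \<in> ?H" for h
  proof -
    interpret S: subset_count "{1..n}" p "rejecting L (patch L h x)" "weight L" "petals L"
      by (rule subset_count_rejecting)
    have "\<gamma> + \<eta> \<le> S.expected_count"
      using sum_rejecting_ge[of "patch L h x" L] rej[OF h] bad by (simp add: expected_count_eq)
    then have "measure_pmf.prob ?R {W. S.count W \<le> ?\<theta>}
        \<le> measure_pmf.prob ?R {W. S.count W \<le> S.expected_count - \<eta> / 2}"
      by (intro measure_pmf.finite_measure_mono) auto
    also have "\<dots> \<le> ?e"
      using assms(3) c beta by (intro S.lower_tail overlap_le) auto
    finally show ?thesis .
  qed
  have finH: "finite ?H" using assms(1) finite_kernel by (intro finite_PiE) auto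
  have "1 - sample_reject_prob n (kernel_sampler \<Sigma> L ?\<theta>) x
      = measure_pmf.prob ?R (UNIV - {W. \<forall>h\<in>?H. ?\<theta> < ?Z h W})"
    unfolding sample_reject_prob_eq using measure_pmf.prob_compl[of "{W. \<forall>h\<in>?H. ?\<theta> < ?Z h W}" ?R] by simp
  also have "UNIV - {W. \<forall>h\<in>?H. ?\<theta> < ?Z h W} = (\<Union>h\<in>?H. {W. ?Z h W \<le> ?\<theta>})"
    by (auto simp: not_less)
  also have "measure_pmf.prob ?R \<dots> \<le> (\<Sum>h\<in>?H. measure_pmf.prob ?R {W. ?Z h W \<le> ?\<theta>})"
    using finH by (intro measure_pmf.finite_measure_subadditive_finite) auto
  also have "\<dots> \<le> (\<Sum>h\<in>?H. ?e)" by (intro sum_mono tail)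
  also have "\<dots> = card \<Sigma> ^ card (kernel L) * ?e"
    using finite_kernel by (simp add: card_PiE)
  finally show ?thesis by simp
qed

end

section \<open>Choice of the parameters\<close>

lemma far_from_patch:
  fixes d \<epsilon> :: real
  assumes "far_from n \<epsilon> x P" "\<And>v. v \<in> {1..n} - K \<Longrightarrow> z v = x v" "finite K" "real (card K) \<le> d * n"
    "1 \<le> n"
  shows "far_from n (\<epsilon> - d) z P"
proof -
  \<comment> \<open>A real \<open>r\<close> strictly in between keeps the inequality strict through
    the infimum and covers an infinite distance.\<close>
  obtain r where r: "ereal \<epsilon> < ereal r" "ereal r < dist_to n x P"
    using assms(1) ereal_dense2[of "ereal \<epsilon>" "dist_to n x P"] unfolding far_from_def by blast
  have "ereal (r - d) \<le> dist_to n z P"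
    unfolding dist_to_def
  proof (rule INF_greatest)
    fix y assume y: "y \<in> P"
    have "{i \<in> {1..n}. x i \<noteq> y i} \<subseteq> {i \<in> {1..n}. z i \<noteq> y i} \<union> K" using assms(2) by auto
    then have "card {i \<in> {1..n}. x i \<noteq> y i} \<le> card ({i \<in> {1..n}. z i \<noteq> y i} \<union> K)"
      using assms(3) by (intro card_mono) auto
    also have "\<dots> \<le> card {i \<in> {1..n}. z i \<noteq> y i} + card K" by (rule card_Un_le)
    finally have "real (card {i \<in> {1..n}. x i \<noteq> y i}) \<le> card {i \<in> {1..n}. z i \<noteq> y i} + d * n"
      using assms(4) by linarith
    then have "rel_dist n x y \<le> rel_dist n z y + d"
      using assms(5) by (simp add: rel_dist_def field_simps)
    moreover have "ereal r < ereal (rel_dist n x y)"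
      using r(2) y unfolding dist_to_def by (meson INF_lower less_le_trans)
    ultimately show "ereal (r - d) \<le> ereal (rel_dist n z y)" by simp
  qed
  moreover have "ereal (\<epsilon> - d) < ereal (r - d)" using r(1) by simp
  ultimately show ?thesis unfolding far_from_def by (rule less_le_trans[rotated])
qed

text \<open>\<open>c_le\<close> brings both error bounds below 1/3, and \<open>kernel_le\<close>
  keeps the kernel at most \<open>\<epsilon> / 2 * n\<close>. The clause on
  \<open>reject_prob T x = 0\<close> lets one tester serve the one-sided case too.\<close>

lemma exists_sampling_tester:
  fixes \<Sigma> :: "'a set" and p c \<gamma> \<delta> \<eta> \<epsilon> :: real
  assumes T: "nonadaptive_tester n T" "max_queries T \<le> q"
    and c: "0 < c" "c < 1" and p: "0 < p" "p \<le> 1"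
    and words: "finite \<Sigma>" "P \<subseteq> words n \<Sigma>"
    and accept: "\<And>x. x \<in> P \<Longrightarrow> reject_prob T x \<le> \<gamma>"
    and reject: "\<And>x. x \<in> words n \<Sigma> \<Longrightarrow> far_from n (\<epsilon> / 2) x P \<Longrightarrow> \<delta> \<le> reject_prob T x"
    and \<gamma>: "0 \<le> \<gamma>" and \<eta>: "0 < \<eta>" "q / (real m + 1) \<le> \<delta> - \<gamma> - \<eta>"
    and c_le: "8 * 2 ^ q * c * (q * ln (real (card \<Sigma>) + 1) + 2) \<le> \<eta>\<^sup>2"
    and kernel_le: "q \<le> (c * p) ^ m * (\<epsilon> / 2) * n" and n: "1 \<le> n"
  shows "\<exists>S. sampling_rate S = p \<and>
    (\<forall>x\<in>P. sample_reject_prob n S x \<le> 1/3 \<and> (reject_prob T x = 0 \<longrightarrow> sample_reject_prob n S x = 0)) \<and>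
    (\<forall>x\<in>words n \<Sigma>. far_from n \<epsilon> x P \<longrightarrow> sample_reject_prob n S x \<ge> 2/3)"
proof -
  interpret query_tester n q T c p using T c p by unfold_locales
  obtain L where L: "L \<le> m"
      "measure_pmf.prob (test_dist T) {t. crowded degree \<beta> (queries t) L} \<le> q / (real m + 1)"
    using exists_level by blast
  let ?S = "kernel_sampler \<Sigma> L (\<gamma> + \<eta> / 2)"
  \<comment> \<open>There are at most \<open>exp (a / \<beta> ^ L)\<close> guesses; the
    \<open>+ 1\<close> keeps \<open>a\<close> nonnegative for every alphabet size.\<close>
  define a where "a = q * ln (real (card \<Sigma>) + 1)"
  have a: "0 \<le> a" by (simp add: a_def)
  have D: "0 < \<beta> ^ L" "\<beta> ^ L \<le> 1" using beta by (auto intro: power_le_one)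
  have c_le': "8 * 2 ^ q * c * (a + 2) \<le> \<eta>\<^sup>2" using c_le by (simp add: a_def)
  have "0 \<le> 2 ^ q * c * (8 * a + 4)" using a c by simp
  then have "2 ^ q * c \<le> 1/3 * (\<eta> / 2)\<^sup>2" using c_le' by (simp add: power_divide algebra_simps)
  moreover have "2 ^ q * c * \<beta> ^ L \<le> 2 ^ q * c" using c D by simp
  ultimately have "2 ^ q * c * \<beta> ^ L \<le> 1/3 * (\<eta> / 2)\<^sup>2" by (rule order_trans[rotated])
  then have member: "2 ^ q * c * \<beta> ^ L / (\<eta> / 2)\<^sup>2 \<le> 1/3" using \<eta> by (simp add: divide_le_eq)
  have "real (card (kernel L)) \<le> q / \<beta> ^ L"
    using card_kernel[of L] D by (simp add: field_simps)
  \<comment> \<open>Only \<open>L \<le> m\<close> is known, so the kernel condition is assumed at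
    \<open>m\<close>, the worst level.\<close>
  have "real (card (kernel L)) * \<beta> ^ L \<le> \<beta> ^ m * (\<epsilon> / 2 * n)"
    using card_kernel[of L] kernel_le by (simp add: mult.assoc)
  also have "\<dots> \<le> \<beta> ^ L * (\<epsilon> / 2 * n)"
  proof (rule mult_right_mono)
    show "\<beta> ^ m \<le> \<beta> ^ L" using L beta by (intro power_decreasing) auto
    have "0 \<le> \<beta> ^ m * (\<epsilon> / 2 * n)" using kernel_le by (simp add: mult.assoc)
    then show "0 \<le> \<epsilon> / 2 * n" using zero_less_power[OF beta(1)] by (meson mult_pos_neg not_le)
  qed
  finally have small: "real (card (kernel L)) \<le> \<epsilon> / 2 * n"
    using D by (simp add: mult.commute)
  have far: "2/3 \<le> sample_reject_prob n ?S x" if x: "x \<in> words n \<Sigma>" "far_from n \<epsilon> x P" for x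
  proof -
    have "\<delta> \<le> reject_prob T (patch L h x)" if h: "h \<in> kernel L \<rightarrow>\<^sub>E \<Sigma>" for h
    proof (rule reject)
      show "patch L h x \<in> words n \<Sigma>"
        using x(1) h by (auto simp: words_def patch_def kernel_def PiE_def Pi_def extensional_def)
      have "far_from n (\<epsilon> - \<epsilon> / 2) (patch L h x) P"
        using far_from_patch[OF x(2) _ finite_kernel small n] by (simp add: patch_def)
      then show "far_from n (\<epsilon> / 2) (patch L h x) P" by simp
    qed
    then have "1 - card \<Sigma> ^ card (kernel L) * exp (- (\<eta> / 2)\<^sup>2 / (2 * (2 ^ q * c * \<beta> ^ L)))
        \<le> sample_reject_prob n ?S x"
      using L(2) \<eta> words(1) by (intro kernel_sampler_far[where \<delta> = \<delta>]) auto
    moreover have "card \<Sigma> ^ card (kernel L) * exp (- (\<eta> / 2)\<^sup>2 / (2 * (2 ^ q * c * \<beta> ^ L))) \<le> 1/3"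
    proof -
      have "real (card \<Sigma>) ^ card (kernel L) \<le> exp (ln (real (card \<Sigma>) + 1)) ^ card (kernel L)"
        by (intro power_mono) auto
      also have "\<dots> = exp (card (kernel L) * ln (real (card \<Sigma>) + 1))"
        by (simp add: exp_of_nat_mult)
      also have "\<dots> \<le> exp (a / \<beta> ^ L)"
        using mult_right_mono[OF \<open>real (card (kernel L)) \<le> q / \<beta> ^ L\<close>, of "ln (real (card \<Sigma>) + 1)"]
        by (simp add: a_def)
      finally have 1: "real (card \<Sigma>) ^ card (kernel L) \<le> exp (a / \<beta> ^ L)" .
      \<comment> \<open>The 8 in \<open>c_le\<close> is the 4 of \<open>(\<eta> / 2)\<^sup>2\<close>
        times Janson's 2. Of \<open>a + 2\<close>, the \<open>a\<close> cancels the number of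
        guesses and the 2 leaves \<open>exp (- 2) \<le> 1/3\<close>.\<close>
      have "(a + 2) / y \<le> (\<eta> / 2)\<^sup>2 / (2 * (2 ^ q * c * y))" if "0 < y" for y
        using mult_right_mono[OF c_le', of y] c that by (simp add: field_simps power_divide)
      from this[OF D(1)] have 2: "exp (- (\<eta> / 2)\<^sup>2 / (2 * (2 ^ q * c * \<beta> ^ L))) \<le> exp (- ((a + 2) / \<beta> ^ L))" by simp
      have "real (card \<Sigma>) ^ card (kernel L) * exp (- (\<eta> / 2)\<^sup>2 / (2 * (2 ^ q * c * \<beta> ^ L)))
          \<le> exp (a / \<beta> ^ L) * exp (- ((a + 2) / \<beta> ^ L))"
        by (intro mult_mono 1 2) auto
      also have "\<dots> = exp (- (2 / \<beta> ^ L))"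
        by (simp add: exp_add[symmetric] add_divide_distrib)
      also have "\<dots> \<le> exp (- 2)" using D by (simp add: field_simps)
      also have "\<dots> \<le> 1/3" using exp_ge_add_one_self[of 2] by (simp add: exp_minus field_simps)
      finally show ?thesis by simp
    qed
    ultimately show ?thesis by linarith
  qed
  show ?thesis
  proof (intro exI[of _ ?S] conjI ballI impI)
    show "sampling_rate ?S = p" by (simp add: kernel_sampler_def)
    fix x assume x: "x \<in> P"
    then have "x \<in> words n \<Sigma>" using words(2) by blast
    then show "sample_reject_prob n ?S x \<le> 1/3"
      using kernel_sampler_member[OF _ accept[OF x] \<eta>(1), of \<Sigma> L] member by linarith
    show "sample_reject_prob n ?S x = 0" if "reject_prob T x = 0"
      using kernel_sampler_one_sided[OF \<open>x \<in> words n \<Sigma>\<close> that] \<gamma> \<eta> by simp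
  qed (use far in blast)
qed

text \<open>
  The sampling rate is \<open>n powr (- 1 / (m + 1))\<close> with \<open>m = \<lfloor>q / (\<delta> - \<gamma>)\<rfloor>\<close>. As \<open>p ^ m * n = 1 / p\<close>
  is unbounded, the kernels are eventually smaller than \<open>\<epsilon> / 2 * n\<close>, and no constant is
  needed in the sample complexity.
\<close>

lemma eventually_sampling_tester:
  fixes \<gamma> \<delta> \<epsilon> :: real
  assumes "0 \<le> \<gamma>" "\<gamma> < \<delta>" "\<delta> \<le> 1" "0 < \<epsilon>"
  shows "\<exists>n0. \<forall>n\<ge>n0. \<forall>(\<Sigma> :: 'a set) P T. finite \<Sigma> \<longrightarrow> card \<Sigma> = k \<longrightarrow> P \<subseteq> words n \<Sigma> \<longrightarrow>
    nonadaptive_tester n T \<longrightarrow> max_queries T \<le> q \<longrightarrow> (\<forall>x\<in>P. reject_prob T x \<le> \<gamma>) \<longrightarrow>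
    (\<forall>x\<in>words n \<Sigma>. far_from n (\<epsilon>/2) x P \<longrightarrow> reject_prob T x \<ge> \<delta>) \<longrightarrow>
    (\<exists>S. sample_based_tester S \<and>
      (\<forall>x\<in>P. sample_reject_prob n S x \<le> 1/3 \<and> (reject_prob T x = 0 \<longrightarrow> sample_reject_prob n S x = 0)) \<and>
      (\<forall>x\<in>words n \<Sigma>. far_from n \<epsilon> x P \<longrightarrow> sample_reject_prob n S x \<ge> 2/3) \<and>
      expected_samples n S = real n powr (1 - 1 / (of_int \<lfloor>real q / (\<delta> - \<gamma>)\<rfloor> + 1)))"
proof -
  define m where "m = nat \<lfloor>real q / (\<delta> - \<gamma>)\<rfloor>"
  have m: "real m = of_int \<lfloor>real q / (\<delta> - \<gamma>)\<rfloor>" using assms by (simp add: m_def)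
  \<comment> \<open>The gap that remains after discarding the crowded tests; it is positive because
    \<open>m + 1\<close> exceeds \<open>q / (\<delta> - \<gamma>)\<close>.\<close>
  define \<eta> where "\<eta> = \<delta> - \<gamma> - q / (real m + 1)"
  have "real q / (\<delta> - \<gamma>) < real m + 1" unfolding m by linarith
  then have \<eta>: "0 < \<eta>" using assms by (simp add: \<eta>_def field_simps)
  have "\<eta> \<le> 1" using assms by (simp add: \<eta>_def) (smt (verit) divide_nonneg_nonneg of_nat_0_le_iff)
  define b where "b = 8 * 2 ^ q * (q * ln (real k + 1) + 2)"
  have "8 * 1 * 2 \<le> b" unfolding b_def by (intro mult_mono) auto
  then have b: "1 < b" by simp
  \<comment> \<open>Makes \<open>c_le\<close> an equality. \<open>\<epsilon>\<close> enters only
    through \<open>n0\<close>.\<close>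
  define c where "c = \<eta>\<^sup>2 / b"
  have c: "0 < c" "c < 1" "c * b = \<eta>\<^sup>2"
    using \<eta> \<open>\<eta> \<le> 1\<close> b power_le_one[of \<eta> 2] by (auto simp: c_def divide_less_eq)
  define p where "p n = real n powr (- 1 / (real m + 1))" for n :: nat
  have p: "0 < p n" "p n \<le> 1" "p n ^ m * n = 1 / p n" if "1 \<le> n" for n
  proof -
    show "0 < p n" using that by (simp add: p_def)
    show "p n \<le> 1" using that powr_mono[of "- 1 / (real m + 1)" 0 "real n"] by (simp add: p_def)
    have "p n ^ Suc m = real n powr (- 1)"
      using that by (simp add: p_def powr_power field_simps del: power_Suc)
    then show "p n ^ m * n = 1 / p n" using \<open>0 < p n\<close> that by (simp add: powr_minus field_simps)
  qed
  have "p \<longlonglongrightarrow> 0"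
    unfolding p_def by (intro tendsto_neg_powr filterlim_real_sequentially) auto
  \<comment> \<open>This is \<open>kernel_le\<close> solved for \<open>p n\<close>;
    \<open>q + 1\<close> keeps the denominator positive.\<close>
  then have "\<forall>\<^sub>F n in sequentially. p n < c ^ m * (\<epsilon> / 2) / (real q + 1)"
    using c assms by (intro order_tendstoD) auto
  then obtain n0 where n0: "\<And>n. n0 \<le> n \<Longrightarrow> p n < c ^ m * (\<epsilon> / 2) / (real q + 1)"
    unfolding eventually_sequentially by blast
  show ?thesis
  proof (intro exI[of _ "max 1 n0"] allI impI)
    fix n \<Sigma> P and T :: "'a tester"
    assume n: "max 1 n0 \<le> n" and words: "finite (\<Sigma> :: 'a set)" "card \<Sigma> = k" "P \<subseteq> words n \<Sigma>"
      and T: "nonadaptive_tester n T" "max_queries T \<le> q"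
      and acc: "\<forall>x\<in>P. reject_prob T x \<le> \<gamma>"
      and rej: "\<forall>x\<in>words n \<Sigma>. far_from n (\<epsilon>/2) x P \<longrightarrow> \<delta> \<le> reject_prob T x"
    have n1: "1 \<le> n" using n by simp
    have "p n * (real q + 1) \<le> c ^ m * (\<epsilon> / 2)" using n0[of n] n by (simp add: field_simps)
    then have "real q + 1 \<le> c ^ m * (\<epsilon> / 2) * (p n ^ m * n)"
      unfolding p(3)[OF n1] using p(1)[OF n1] by (simp add: pos_le_divide_eq mult_ac)
    then have kernel: "real q \<le> (c * p n) ^ m * (\<epsilon> / 2) * n"
      by (simp add: power_mult_distrib mult_ac)
    have "\<exists>S. sampling_rate S = p n \<and>
      (\<forall>x\<in>P. sample_reject_prob n S x \<le> 1/3 \<and> (reject_prob T x = 0 \<longrightarrow> sample_reject_prob n S x = 0)) \<and>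
      (\<forall>x\<in>words n \<Sigma>. far_from n \<epsilon> x P \<longrightarrow> sample_reject_prob n S x \<ge> 2/3)"
    proof (rule exists_sampling_tester[OF T c(1,2) p(1,2)[OF n1] words(1,3) _ _ assms(1) \<eta> _ _ kernel n1])
      show "q / (real m + 1) \<le> \<delta> - \<gamma> - \<eta>" by (simp add: \<eta>_def)
      show "8 * 2 ^ q * c * (q * ln (real (card \<Sigma>) + 1) + 2) \<le> \<eta>\<^sup>2"
        using c(3) words(2) by (simp add: b_def mult_ac)
    qed (use acc rej in auto)
    then obtain S where S: "sampling_rate S = p n"
      "\<forall>x\<in>P. sample_reject_prob n S x \<le> 1/3 \<and> (reject_prob T x = 0 \<longrightarrow> sample_reject_prob n S x = 0)"
      "\<forall>x\<in>words n \<Sigma>. far_from n \<epsilon> x P \<longrightarrow> sample_reject_prob n S x \<ge> 2/3" by blast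
    have based: "sample_based_tester S" using S(1) p[OF n1] by (simp add: sample_based_tester_def)
    have "expected_samples n S = p n * real n powr 1"
      using n1 by (simp add: expected_samples_eq[OF based] S(1))
    also have "\<dots> = real n powr (1 - 1 / (real m + 1))"
      unfolding p_def powr_add[symmetric] by simp
    finally show "\<exists>S. sample_based_tester S \<and>
      (\<forall>x\<in>P. sample_reject_prob n S x \<le> 1/3 \<and> (reject_prob T x = 0 \<longrightarrow> sample_reject_prob n S x = 0)) \<and>
      (\<forall>x\<in>words n \<Sigma>. far_from n \<epsilon> x P \<longrightarrow> sample_reject_prob n S x \<ge> 2/3) \<and>
      expected_samples n S = real n powr (1 - 1 / (of_int \<lfloor>real q / (\<delta> - \<gamma>)\<rfloor> + 1))"
      using based S unfolding m by blast
  qed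
qed

section \<open>The one-sided, two-sided and special cases\<close>

lemma sample_accept_prob_eq: "sample_accept_prob n S x = 1 - sample_reject_prob n S x"
  by (simp add: sample_accept_prob_def sample_reject_prob_def pmf_False_conv_True)

theorem corollary1p3:
  shows
    "\<exists>(C\<^sub>1 :: nat \<Rightarrow> real \<Rightarrow> nat \<Rightarrow> real) (C\<^sub>2 :: nat \<Rightarrow> real \<Rightarrow> real \<Rightarrow> nat \<Rightarrow> real).
      (\<forall>(q::nat) (\<delta>::real) (k::nat) (\<epsilon>::real).
         1 \<le> q \<and> 0 < \<delta> \<and> \<delta> \<le> 1 \<and> 0 < \<epsilon> \<and> \<epsilon> \<le> 1 \<longrightarrow>
         (\<exists>n\<^sub>0::nat. \<forall>n\<ge>n\<^sub>0. \<forall>(\<Sigma> :: 'a set) P.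
            finite \<Sigma> \<and> card \<Sigma> = k \<and> P \<subseteq> words n \<Sigma> \<and>
            (\<exists>T. nonadaptive_tester n T \<and> max_queries T \<le> q \<and> one_sided T P \<and>
                 (\<forall>x\<in>words n \<Sigma>. far_from n (\<epsilon>/2) x P \<longrightarrow> reject_prob T x \<ge> \<delta>)) \<longrightarrow>
            (\<exists>S. sample_based_tester S \<and>
                 (\<forall>x\<in>P. sample_reject_prob n S x = 0) \<and>
                 (\<forall>x\<in>words n \<Sigma>. far_from n \<epsilon> x P \<longrightarrow> sample_reject_prob n S x \<ge> 2/3) \<and>
                 expected_samples n S
                   \<le> C\<^sub>1 q \<delta> k * real n powr (1 - 1 / (of_int \<lfloor>real q / \<delta>\<rfloor> + 1))))) \<and>
      (\<forall>(q::nat) (\<gamma>::real) (\<delta>::real) (k::nat) (\<epsilon>::real).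
         1 \<le> q \<and> 0 \<le> \<gamma> \<and> \<gamma> < \<delta> \<and> \<delta> \<le> 1 \<and> 0 < \<epsilon> \<and> \<epsilon> \<le> 1 \<longrightarrow>
         (\<exists>n\<^sub>0::nat. \<forall>n\<ge>n\<^sub>0. \<forall>(\<Sigma> :: 'a set) P.
            finite \<Sigma> \<and> card \<Sigma> = k \<and> P \<subseteq> words n \<Sigma> \<and>
            (\<exists>T. nonadaptive_tester n T \<and> max_queries T \<le> q \<and>
                 (\<forall>x\<in>P. reject_prob T x \<le> \<gamma>) \<and>
                 (\<forall>x\<in>words n \<Sigma>. far_from n (\<epsilon>/2) x P \<longrightarrow> reject_prob T x \<ge> \<delta>)) \<longrightarrow>
            (\<exists>S. sample_based_tester S \<and>
                 (\<forall>x\<in>P. sample_accept_prob n S x \<ge> 2/3) \<and>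
                 (\<forall>x\<in>words n \<Sigma>. far_from n \<epsilon> x P \<longrightarrow> sample_reject_prob n S x \<ge> 2/3) \<and>
                 expected_samples n S
                   \<le> C\<^sub>2 q \<gamma> \<delta> k * real n powr (1 - 1 / (of_int \<lfloor>real q / (\<delta> - \<gamma>)\<rfloor> + 1))))) \<and>
      (\<forall>(q::nat) (k::nat). 1 \<le> q \<longrightarrow>
         (\<lambda>n. C\<^sub>2 q (1/3) (2/3) k *
               real n powr (1 - 1 / (of_int \<lfloor>real q / (2/3 - 1/3)\<rfloor> + 1)))
           \<in> O(\<lambda>n. real n powr (1 - 1 / (3 * real q + 1)))) \<and>
      (\<exists>a>0. \<exists>b>0. \<forall>(q::nat) (k::nat). 1 \<le> q \<longrightarrow>
         (\<forall>\<^sub>F n in sequentially. \<exists>\<theta>. a / real q \<le> \<theta> \<and> \<theta> \<le> b / real q \<and>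
            C\<^sub>2 q (1/3) (2/3) k *
               real n powr (1 - 1 / (of_int \<lfloor>real q / (2/3 - 1/3)\<rfloor> + 1))
              = real n powr (1 - \<theta>)))"
proof (rule exI[of _ "\<lambda>_ _ _. 1"], rule exI[of _ "\<lambda>_ _ _ _. 1"], intro conjI allI impI; (elim conjE)?)
  \<comment> \<open>The expected sample size is exactly the power of \<open>n\<close>, so both
    constants are 1. The one-sided case takes \<open>\<gamma> = 0\<close>.\<close>
  fix q k :: nat and \<delta> \<epsilon> :: real
  assume "0 < \<delta>" "\<delta> \<le> 1" "0 < \<epsilon>"
  with eventually_sampling_tester[of 0 \<delta> \<epsilon> k q, where ?'a = 'a] obtain n0 where n0:
    "\<forall>n\<ge>n0. \<forall>(\<Sigma> :: 'a set) P T. finite \<Sigma> \<longrightarrow> card \<Sigma> = k \<longrightarrow> P \<subseteq> words n \<Sigma> \<longrightarrow>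
      nonadaptive_tester n T \<longrightarrow> max_queries T \<le> q \<longrightarrow> (\<forall>x\<in>P. reject_prob T x \<le> 0) \<longrightarrow>
      (\<forall>x\<in>words n \<Sigma>. far_from n (\<epsilon>/2) x P \<longrightarrow> reject_prob T x \<ge> \<delta>) \<longrightarrow>
      (\<exists>S. sample_based_tester S \<and>
        (\<forall>x\<in>P. sample_reject_prob n S x \<le> 1/3 \<and> (reject_prob T x = 0 \<longrightarrow> sample_reject_prob n S x = 0)) \<and>
        (\<forall>x\<in>words n \<Sigma>. far_from n \<epsilon> x P \<longrightarrow> sample_reject_prob n S x \<ge> 2/3) \<and>
        expected_samples n S = real n powr (1 - 1 / (of_int \<lfloor>real q / \<delta>\<rfloor> + 1)))"
    by auto
  show "\<exists>n\<^sub>0::nat. \<forall>n\<ge>n\<^sub>0. \<forall>(\<Sigma> :: 'a set) P.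
        finite \<Sigma> \<and> card \<Sigma> = k \<and> P \<subseteq> words n \<Sigma> \<and>
        (\<exists>T. nonadaptive_tester n T \<and> max_queries T \<le> q \<and> one_sided T P \<and>
             (\<forall>x\<in>words n \<Sigma>. far_from n (\<epsilon>/2) x P \<longrightarrow> reject_prob T x \<ge> \<delta>)) \<longrightarrow>
        (\<exists>S. sample_based_tester S \<and>
             (\<forall>x\<in>P. sample_reject_prob n S x = 0) \<and>
             (\<forall>x\<in>words n \<Sigma>. far_from n \<epsilon> x P \<longrightarrow> sample_reject_prob n S x \<ge> 2/3) \<and>
             expected_samples n S \<le> 1 * real n powr (1 - 1 / (of_int \<lfloor>real q / \<delta>\<rfloor> + 1)))"
  proof (intro exI[of _ n0] allI impI, elim conjE exE)
    fix n P T and \<Sigma> :: "'a set"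
    assume A: "n0 \<le> n" "finite \<Sigma>" "card \<Sigma> = k" "P \<subseteq> words n \<Sigma>" "nonadaptive_tester n T"
      "max_queries T \<le> q" "one_sided T P"
      "\<forall>x\<in>words n \<Sigma>. far_from n (\<epsilon>/2) x P \<longrightarrow> reject_prob T x \<ge> \<delta>"
    have "\<forall>x\<in>P. reject_prob T x \<le> 0" using A(7) by (simp add: one_sided_def)
    from n0[rule_format, OF A(1-6) this[rule_format] A(8)[rule_format]] A(7)
    show "\<exists>S. sample_based_tester S \<and>
             (\<forall>x\<in>P. sample_reject_prob n S x = 0) \<and>
             (\<forall>x\<in>words n \<Sigma>. far_from n \<epsilon> x P \<longrightarrow> sample_reject_prob n S x \<ge> 2/3) \<and>
             expected_samples n S \<le> 1 * real n powr (1 - 1 / (of_int \<lfloor>real q / \<delta>\<rfloor> + 1))"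
      by (auto simp: one_sided_def)
  qed
next
  fix q k :: nat and \<gamma> \<delta> \<epsilon> :: real
  assume *: "0 \<le> \<gamma>" "\<gamma> < \<delta>" "\<delta> \<le> 1" "0 < \<epsilon>"
  obtain n0 where n0: "\<forall>n\<ge>n0. \<forall>(\<Sigma> :: 'a set) P T. finite \<Sigma> \<longrightarrow> card \<Sigma> = k \<longrightarrow> P \<subseteq> words n \<Sigma> \<longrightarrow>
      nonadaptive_tester n T \<longrightarrow> max_queries T \<le> q \<longrightarrow> (\<forall>x\<in>P. reject_prob T x \<le> \<gamma>) \<longrightarrow>
      (\<forall>x\<in>words n \<Sigma>. far_from n (\<epsilon>/2) x P \<longrightarrow> reject_prob T x \<ge> \<delta>) \<longrightarrow>
      (\<exists>S. sample_based_tester S \<and>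
        (\<forall>x\<in>P. sample_reject_prob n S x \<le> 1/3 \<and> (reject_prob T x = 0 \<longrightarrow> sample_reject_prob n S x = 0)) \<and>
        (\<forall>x\<in>words n \<Sigma>. far_from n \<epsilon> x P \<longrightarrow> sample_reject_prob n S x \<ge> 2/3) \<and>
        expected_samples n S = real n powr (1 - 1 / (of_int \<lfloor>real q / (\<delta> - \<gamma>)\<rfloor> + 1)))"
    using eventually_sampling_tester[OF *, of k q, where ?'a = 'a] by (elim exE)
  show "\<exists>n\<^sub>0::nat. \<forall>n\<ge>n\<^sub>0. \<forall>(\<Sigma> :: 'a set) P.
        finite \<Sigma> \<and> card \<Sigma> = k \<and> P \<subseteq> words n \<Sigma> \<and>
        (\<exists>T. nonadaptive_tester n T \<and> max_queries T \<le> q \<and> (\<forall>x\<in>P. reject_prob T x \<le> \<gamma>) \<and>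
             (\<forall>x\<in>words n \<Sigma>. far_from n (\<epsilon>/2) x P \<longrightarrow> reject_prob T x \<ge> \<delta>)) \<longrightarrow>
        (\<exists>S. sample_based_tester S \<and>
             (\<forall>x\<in>P. sample_accept_prob n S x \<ge> 2/3) \<and>
             (\<forall>x\<in>words n \<Sigma>. far_from n \<epsilon> x P \<longrightarrow> sample_reject_prob n S x \<ge> 2/3) \<and>
             expected_samples n S \<le> 1 * real n powr (1 - 1 / (of_int \<lfloor>real q / (\<delta> - \<gamma>)\<rfloor> + 1)))"
  proof (intro exI[of _ n0] allI impI, elim conjE exE)
    fix n P T and \<Sigma> :: "'a set"
    assume A: "n0 \<le> n" "finite \<Sigma>" "card \<Sigma> = k" "P \<subseteq> words n \<Sigma>" "nonadaptive_tester n T"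
      "max_queries T \<le> q" "\<forall>x\<in>P. reject_prob T x \<le> \<gamma>"
      "\<forall>x\<in>words n \<Sigma>. far_from n (\<epsilon>/2) x P \<longrightarrow> reject_prob T x \<ge> \<delta>"
    from n0[rule_format, OF A(1-6) A(7)[rule_format] A(8)[rule_format]]
    show "\<exists>S. sample_based_tester S \<and>
             (\<forall>x\<in>P. sample_accept_prob n S x \<ge> 2/3) \<and>
             (\<forall>x\<in>words n \<Sigma>. far_from n \<epsilon> x P \<longrightarrow> sample_reject_prob n S x \<ge> 2/3) \<and>
             expected_samples n S \<le> 1 * real n powr (1 - 1 / (of_int \<lfloor>real q / (\<delta> - \<gamma>)\<rfloor> + 1))"
      by (force simp: sample_accept_prob_eq)
  qed
next
  fix q k :: nat
  have "\<lfloor>real q / (2/3 - 1/3)\<rfloor> = int (3 * q)"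
    by (simp add: mult.commute floor_eq_iff)
  then show "(\<lambda>n. 1 * real n powr (1 - 1 / (of_int \<lfloor>real q / (2/3 - 1/3)\<rfloor> + 1)))
      \<in> O(\<lambda>n. real n powr (1 - 1 / (3 * real q + 1)))"
    by simp
next
  show "\<exists>a>0. \<exists>b>0. \<forall>(q::nat) (k::nat). 1 \<le> q \<longrightarrow>
      (\<forall>\<^sub>F n in sequentially. \<exists>\<theta>. a / real q \<le> \<theta> \<and> \<theta> \<le> b / real q \<and>
        1 * real n powr (1 - 1 / (of_int \<lfloor>real q / (2/3 - 1/3)\<rfloor> + 1)) = real n powr (1 - \<theta>))"
  proof (rule exI[of _ "1/4"], rule conjI, simp, rule exI[of _ "1/3"], rule conjI, simp,
      intro allI impI always_eventually)
    fix q n :: nat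
    assume q: "1 \<le> q"
    have floor: "\<lfloor>real q / (2/3 - 1/3)\<rfloor> = int (3 * q)"
      by (simp add: mult.commute floor_eq_iff)
    \<comment> \<open>The constants come from
      \<open>3 * q \<le> 3 * q + 1 \<le> 4 * q\<close>.\<close>
    have "1/4 / real q \<le> 1 / (3 * real q + 1)" "1 / (3 * real q + 1) \<le> 1/3 / real q"
      using q by (simp_all add: field_simps)
    then show "\<exists>\<theta>. 1/4 / real q \<le> \<theta> \<and> \<theta> \<le> 1/3 / real q \<and>
        1 * real n powr (1 - 1 / (of_int \<lfloor>real q / (2/3 - 1/3)\<rfloor> + 1)) = real n powr (1 - \<theta>)"
      unfolding floor by (intro exI[of _ "1 / (3 * real q + 1)"]) simp
  qed
qed

end
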